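(* Let $\rho \in \mathcal{S}$ with $\rho > 0$ and $\sigma \in \mathcal{P}$ with $\sigma > 0$, and let $\alpha \in (\frac12, 1)\cup(1,\infty)$. Then $D_{\alpha}^{\mathbb{M}}(\rho\|\sigma) \leq D_{\alpha}(\rho\|\sigma)$, with equality if and only if $\rho\sigma=\sigma\rho$.
   Context: Work on a $d$-dimensional complex Hilbert space; $\mathcal{P}$ positive semidefinite operators, $\mathcal{S}$ density operators, $\log$ natural logarithm. The sandwiched Rényi relative entropy is $D_\alpha(\rho\|\sigma)=\frac{1}{\alpha-1}\log \operatorname{tr}\big[(\sigma^{\frac{1-\alpha}{2\alpha}}\rho\sigma^{\frac{1-\alpha}{2\alpha}})^\alpha\big]$. The measured Rényi relative entropy is $D^{\mathbb{M}}_\alpha(\rho\|\sigma):=\sup_{(\mathcal{X},M)}\frac{1}{\alpha-1}\log\sum_{x}P_{\rho,M}(x)^\alpha P_{\sigma,M}(x)^{1-\alpha}$, supremum over finite sets $\mathcal{X}$ and POVMs $M$ on $\mathcal{X}$ (maps to positive semidefinite operators summing to the identity), with $P_{\rho,M}(x)=\operatorname{tr}[M(x)\rho]$ (terms with $P_{\rho,M}(x)=0$ contribute $0$). *)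

theory Defs
  imports "Jordan_Normal_Form.Schur_Decomposition" "HOL-Library.Extended_Real"
begin

definition mtrace :: "complex mat \<Rightarrow> complex" where
  "mtrace A = (\<Sum>i<dim_row A. A $$ (i, i))"

definition hermitian :: "complex mat \<Rightarrow> bool" where
  "hermitian A \<longleftrightarrow> mat_adjoint A = A"

definition unitary :: "nat \<Rightarrow> complex mat \<Rightarrow> bool" where
  "unitary n U \<longleftrightarrow> U \<in> carrier_mat n n \<and> U * mat_adjoint U = 1\<^sub>m n \<and> mat_adjoint U * U = 1\<^sub>m n"

definition psd :: "nat \<Rightarrow> complex mat \<Rightarrow> bool" where
  "psd d A \<longleftrightarrow> A \<in> carrier_mat d d \<and> hermitian A \<and>
     (\<forall>v \<in> carrier_vec d. 0 \<le> conjugate v \<bullet> (A *\<^sub>v v))"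

definition pd :: "nat \<Rightarrow> complex mat \<Rightarrow> bool" where
  "pd d A \<longleftrightarrow> A \<in> carrier_mat d d \<and> hermitian A \<and>
     (\<forall>v \<in> carrier_vec d. v \<noteq> 0\<^sub>v d \<longrightarrow> 0 < conjugate v \<bullet> (A *\<^sub>v v))"

definition density :: "nat \<Rightarrow> complex mat \<Rightarrow> bool" where
  "density d \<rho> \<longleftrightarrow> psd d \<rho> \<and> mtrace \<rho> = 1"

definition diag_real :: "nat \<Rightarrow> (nat \<Rightarrow> real) \<Rightarrow> complex mat" where
  "diag_real n lam = mat n n (\<lambda>(i, j). if i = j then complex_of_real (lam i) else 0)"

text \<open>A^p := U diag(lambda_i^p) U^*, where A = U diag(lambda) U^* is a spectral decomposition
  (U unitary, lambda real). For positive semidefinite A the eigenvalues are nonnegative;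
  the value does not depend on the chosen decomposition.\<close>
definition mpow :: "complex mat \<Rightarrow> real \<Rightarrow> complex mat" where
  "mpow A p = (let n = dim_row A;
                   (U, lam) = (SOME (U, lam). unitary n U \<and>
                                  A = U * diag_real n lam * mat_adjoint U)
               in U * diag_real n (\<lambda>i. lam i powr p) * mat_adjoint U)"

definition sandwiched_renyi :: "real \<Rightarrow> complex mat \<Rightarrow> complex mat \<Rightarrow> real" where
  "sandwiched_renyi \<alpha> \<rho> \<sigma> =
     1 / (\<alpha> - 1) * ln (Re (mtrace (mpow (mpow \<sigma> ((1 - \<alpha>) / (2 * \<alpha>)) * \<rho> *
                                        mpow \<sigma> ((1 - \<alpha>) / (2 * \<alpha>))) \<alpha>)))"

definition povm :: "nat \<Rightarrow> nat set \<Rightarrow> (nat \<Rightarrow> complex mat) \<Rightarrow> bool" where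
  "povm d X M \<longleftrightarrow> finite X \<and> (\<forall>x\<in>X. psd d (M x)) \<and> (\<forall>i<d. \<forall>j<d. (\<Sum>x\<in>X. M x $$ (i, j)) = (if i = j then 1 else 0))"

definition prob_meas :: "complex mat \<Rightarrow> (nat \<Rightarrow> complex mat) \<Rightarrow> nat \<Rightarrow> real" where
  "prob_meas \<rho> M x = Re (mtrace (M x * \<rho>))"

definition renyi_sum :: "real \<Rightarrow> complex mat \<Rightarrow> complex mat \<Rightarrow> nat set \<Rightarrow> (nat \<Rightarrow> complex mat) \<Rightarrow> real" where
  "renyi_sum \<alpha> \<rho> \<sigma> X M =
     (\<Sum>x\<in>X. if prob_meas \<rho> M x = 0 then 0
             else prob_meas \<rho> M x powr \<alpha> * prob_meas \<sigma> M x powr (1 - \<alpha>))"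

definition measured_renyi :: "nat \<Rightarrow> real \<Rightarrow> complex mat \<Rightarrow> complex mat \<Rightarrow> ereal" where
  "measured_renyi d \<alpha> \<rho> \<sigma> =
     (SUP (X, M) \<in> {(X, M). povm d X M}. ereal (1 / (\<alpha> - 1) * ln (renyi_sum \<alpha> \<rho> \<sigma> X M)))"

end

theory Submission
  imports "HOL-Complex_Analysis.Conformal_Mappings" "HOL-Analysis.Function_Topology"
    "Jordan_Normal_Form.Spectral_Radius" Defs
begin

text \<open>
  Put \<open>b = (\<alpha> - 1)/\<alpha>\<close>, \<open>X = \<sigma>\<^sup>-\<^sup>b\<^sup>/\<^sup>2 \<rho> \<sigma>\<^sup>-\<^sup>b\<^sup>/\<^sup>2\<close> and \<open>Q = tr X\<^sup>\<alpha>\<close>. For an orthonormal basis \<open>W\<close> with outcome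
  weights \<open>P\<^sub>i, Q\<^sub>i\<close> let \<open>f = \<Sum>\<^sub>i P\<^sub>i\<^sup>\<alpha> Q\<^sub>i\<^sup>1\<^sup>-\<^sup>\<alpha>\<close> and let \<open>\<omega>\<close> be diagonal in \<open>W\<close> with eigenvalues \<open>(P\<^sub>i/Q\<^sub>i)\<^sup>\<alpha>\<close>, so
  that \<open>tr \<rho> \<omega>\<^sup>b = tr \<sigma> \<omega> = f\<close>. With \<open>C = X\<^sup>1\<^sup>/\<^sup>2 \<sigma>\<^sup>b\<^sup>/\<^sup>2 \<omega>\<^sup>b\<^sup>/\<^sup>2\<close> and
  \<open>Z(z) = \<omega>\<^sup>z\<^sup>/\<^sup>2 \<sigma>\<^sup>z\<^sup>/\<^sup>2 X\<^sup>\<alpha>\<^sup>(\<^sup>1\<^sup>-\<^sup>z\<^sup>)\<^sup>/\<^sup>2\<close>, the function \<open>h(z) = tr (C Z(z))\<close> is bounded by \<open>(f Q)\<^sup>1\<^sup>/\<^sup>2\<close> on \<open>Re z = 0\<close> and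
  by \<open>f\<close> on \<open>Re z = 1\<close>, while \<open>h(b) = f\<close> and \<open>h(-b) = Q\<close>. The three lines theorem at \<open>\<bar>b\<bar> < 1\<close> compares
  \<open>f\<close> with \<open>Q\<close> in the required direction. If \<open>f = Q\<close> then \<open>h\<close> is constant by the maximum principle and
  equality in Cauchy--Schwarz gives \<open>Z(0) = Z(1)\<close>, that is \<open>X\<^sup>\<alpha>\<^sup>/\<^sup>2 = \<omega>\<^sup>1\<^sup>/\<^sup>2 \<sigma>\<^sup>1\<^sup>/\<^sup>2\<close>; both sides being Hermitian,
  \<open>X\<close> and hence \<open>\<rho>\<close> commute with \<open>\<sigma>\<close>.

  A second application of the three lines theorem, a form of the operator Jensen inequality, shows that
  no POVM does better than the eigenbasis of \<open>\<Sum>\<^sub>x (p\<^sub>x/q\<^sub>x)\<^sup>\<alpha> M\<^sub>x\<close>. The supremum is therefore bounded by a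
  maximum over the compact unitary group, and strictness at each basis gives strictness of the supremum.
\<close>

declare index_mult_mat(1) [simp del] assoc_mult_mat [simp del] carrier_matD [simp del]
  mult_carrier_mat [simp del]

section \<open>Adjoints, traces and unitary conjugation\<close>

notation mat_adjoint (\<open>_\<^sup>\<dagger>\<close> [1000] 1000)

lemma adjoint_dim [simp]: "dim_row (A\<^sup>\<dagger>) = dim_col A" "dim_col (A\<^sup>\<dagger>) = dim_row A"
  by (simp_all add: mat_adjoint_def)

lemma adjoint_index:
  "i < dim_col A \<Longrightarrow> j < dim_row A \<Longrightarrow> A\<^sup>\<dagger> $$ (i, j) = cnj (A $$ (j, i))" for A :: "complex mat"
  by (simp add: mat_adjoint_def mat_of_rows_def cols_def)

lemma adjoint_carrier: "A \<in> carrier_mat n m \<Longrightarrow> A\<^sup>\<dagger> \<in> carrier_mat m n"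
  unfolding carrier_mat_def by simp

lemma adjoint_adjoint [simp]: "A\<^sup>\<dagger>\<^sup>\<dagger> = A" for A :: "complex mat"
  by (intro eq_matI) (auto simp: adjoint_index)

lemma sum_scalar_prod_index:
  "i < dim_row A \<Longrightarrow> j < dim_col B \<Longrightarrow> dim_col A = dim_row B \<Longrightarrow>
    (A * B) $$ (i, j) = (\<Sum>k<dim_row B. A $$ (i, k) * B $$ (k, j))"
  by (simp add: index_mult_mat(1) scalar_prod_def lessThan_atLeast0)

lemma adjoint_mult:
  "dim_col A = dim_row B \<Longrightarrow> (A * B)\<^sup>\<dagger> = B\<^sup>\<dagger> * A\<^sup>\<dagger>" for A B :: "complex mat"
  by (intro eq_matI) (auto simp: adjoint_index sum_scalar_prod_index mult.commute)

lemma mtrace_mult: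
  "dim_row A = dim_col B \<Longrightarrow> dim_col A = dim_row B \<Longrightarrow>
    mtrace (A * B) = (\<Sum>i<dim_row A. \<Sum>j<dim_col A. A $$ (i, j) * B $$ (j, i))"
  by (simp add: mtrace_def sum_scalar_prod_index)

lemma mtrace_comm:
  "dim_row A = dim_col B \<Longrightarrow> dim_col A = dim_row B \<Longrightarrow> mtrace (A * B) = mtrace (B * A)"
  by (simp add: mtrace_mult) (subst sum.swap, simp add: mult.commute)

definition diagonal_matrix :: "nat \<Rightarrow> (nat \<Rightarrow> complex) \<Rightarrow> complex mat" where
  "diagonal_matrix n l = mat n n (\<lambda>(i, j). if i = j then l i else 0)"

text \<open>The eigenvalues may be complex, so that normal matrices and complex powers of positive
  matrices are covered along with Hermitian ones.\<close>

definition spectral_mat :: "nat \<Rightarrow> complex mat \<Rightarrow> (nat \<Rightarrow> complex) \<Rightarrow> complex mat" where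
  "spectral_mat n U l = U * diagonal_matrix n l * U\<^sup>\<dagger>"

text \<open>For unitary \<open>U\<close> this is the weight of \<open>A\<close> at outcome
  \<open>i\<close> of the projective measurement in the columns of \<open>U\<close>; the real part
  loses nothing when \<open>A\<close> is positive.\<close>

definition diag_in :: "complex mat \<Rightarrow> complex mat \<Rightarrow> nat \<Rightarrow> real" where
  "diag_in U A i = Re ((U\<^sup>\<dagger> * A * U) $$ (i, i))"

text \<open>The square of the Hilbert-Schmidt norm.\<close>

definition hs :: "complex mat \<Rightarrow> real" where
  "hs A = (\<Sum>i<dim_row A. \<Sum>j<dim_col A. (cmod (A $$ (i, j)))\<^sup>2)"

lemma diag_real_eq: "diag_real n l = diagonal_matrix n (\<lambda>i. complex_of_real (l i))"
  by (simp add: diag_real_def diagonal_matrix_def)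

lemma hs_eq_mtrace: "complex_of_real (hs A) = mtrace (A\<^sup>\<dagger> * A)"
  apply (simp add: hs_def mtrace_mult adjoint_index del: of_real_power)
  apply (subst sum.swap)
  apply (intro sum.cong refl)
  apply (metis complex_norm_square mult.commute of_real_power)
  done

lemma hs_adjoint: "hs (A\<^sup>\<dagger>) = hs A"
  apply (simp add: hs_def)
  apply (subst sum.swap)
  apply (simp add: adjoint_index)
  done

context
  fixes n :: nat
begin

lemma dim_square [simp]:
  "A \<in> carrier_mat n n \<Longrightarrow> dim_row A = n" "A \<in> carrier_mat n n \<Longrightarrow> dim_col A = n" for A :: "complex mat"
  by (simp_all add: carrier_matD)

lemma adjoint_square [simp]: "A \<in> carrier_mat n n \<Longrightarrow> A\<^sup>\<dagger> \<in> carrier_mat n n" for A :: "complex mat"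
  by (rule adjoint_carrier)

lemma mult_square [simp]:
  "A \<in> carrier_mat n n \<Longrightarrow> B \<in> carrier_mat n n \<Longrightarrow> A * B \<in> carrier_mat n n" for A :: "complex mat"
  by (rule mult_carrier_mat)

lemma assoc_square:
  "A \<in> carrier_mat n n \<Longrightarrow> B \<in> carrier_mat n n \<Longrightarrow> C \<in> carrier_mat n n \<Longrightarrow> (A * B) * C = A * (B * C)"
  for A :: "complex mat"
  by (rule assoc_mult_mat)

lemma one_square:
  "A \<in> carrier_mat n n \<Longrightarrow> 1\<^sub>m n * A = A" "A \<in> carrier_mat n n \<Longrightarrow> A * 1\<^sub>m n = A"
  for A :: "complex mat"
  by auto

lemma adjoint_mult_square:
  "A \<in> carrier_mat n n \<Longrightarrow> B \<in> carrier_mat n n \<Longrightarrow> (A * B)\<^sup>\<dagger> = B\<^sup>\<dagger> * A\<^sup>\<dagger>" for A :: "complex mat"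
  by (intro adjoint_mult) auto

lemma mtrace_comm_square:
  "A \<in> carrier_mat n n \<Longrightarrow> B \<in> carrier_mat n n \<Longrightarrow> mtrace (A * B) = mtrace (B * A)"
  by (intro mtrace_comm) auto

lemma index_square:
  "A \<in> carrier_mat n n \<Longrightarrow> B \<in> carrier_mat n n \<Longrightarrow> i < n \<Longrightarrow> j < n \<Longrightarrow>
    (A * B) $$ (i, j) = (\<Sum>k<n. A $$ (i, k) * B $$ (k, j))" for A :: "complex mat"
  by (subst sum_scalar_prod_index) auto

lemma mtrace_square:
  "A \<in> carrier_mat n n \<Longrightarrow> B \<in> carrier_mat n n \<Longrightarrow>
    mtrace (A * B) = (\<Sum>i<n. \<Sum>j<n. A $$ (i, j) * B $$ (j, i))"
  by (subst mtrace_mult) auto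

section \<open>Unitary matrices in a fixed dimension\<close>

lemma unitary_carrier [simp]: "unitary n U \<Longrightarrow> U \<in> carrier_mat n n"
  by (simp add: unitary_def)

lemma unitary_dim [simp]: "unitary n U \<Longrightarrow> dim_row U = n" "unitary n U \<Longrightarrow> dim_col U = n"
  by (simp_all add: unitary_def carrier_matD)

lemma unitary_cancel [simp]:
  assumes "unitary n U"
  shows "U * U\<^sup>\<dagger> = 1\<^sub>m n" "U\<^sup>\<dagger> * U = 1\<^sub>m n"
    "A \<in> carrier_mat n n \<Longrightarrow> U * (U\<^sup>\<dagger> * A) = A"
    "A \<in> carrier_mat n n \<Longrightarrow> U\<^sup>\<dagger> * (U * A) = A"
proof -
  note U = assms[unfolded unitary_def]
  show 1: "U * U\<^sup>\<dagger> = 1\<^sub>m n" "U\<^sup>\<dagger> * U = 1\<^sub>m n"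
    using U by blast+
  show "U * (U\<^sup>\<dagger> * A) = A" if "A \<in> carrier_mat n n"
    using U that assoc_square[of U "U\<^sup>\<dagger>" A] one_square(1)[of A] 1(1) adjoint_carrier[of U n n]
    by argo
  show "U\<^sup>\<dagger> * (U * A) = A" if "A \<in> carrier_mat n n"
    using U that assoc_square[of "U\<^sup>\<dagger>" U A] one_square(1)[of A] 1(2) adjoint_carrier[of U n n]
    by argo
qed

lemma unitary_mult: "unitary n U \<Longrightarrow> unitary n V \<Longrightarrow> unitary n (U * V)"
  by (subst unitary_def) (simp add: adjoint_mult_square assoc_square)

lemma unitaryI:
  assumes "U \<in> carrier_mat n n" "U\<^sup>\<dagger> * U = 1\<^sub>m n"
  shows "unitary n U"
  unfolding unitary_def using assms mat_mult_left_right_inverse[of "U\<^sup>\<dagger>" n U] by simp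

section \<open>Diagonal matrices and matrices diagonal in a unitary basis\<close>

lemma diagonal_matrix_carrier [simp]: "diagonal_matrix n l \<in> carrier_mat n n"
  by (simp add: diagonal_matrix_def)

lemma diagonal_matrix_dim [simp]:
  "dim_row (diagonal_matrix n l) = n" "dim_col (diagonal_matrix n l) = n"
  by (simp_all add: diagonal_matrix_def)

lemma diagonal_matrix_mult_index:
  assumes "A \<in> carrier_mat n n" "i < n" "j < n"
  shows "(diagonal_matrix n l * A) $$ (i, j) = l i * A $$ (i, j)"
    and "(A * diagonal_matrix n l) $$ (i, j) = A $$ (i, j) * l j"
  using assms by (auto simp: index_square diagonal_matrix_def if_distrib if_distribR cong: if_cong)

lemma diagonal_matrix_mult:
  "diagonal_matrix n l * diagonal_matrix n m = diagonal_matrix n (\<lambda>i. l i * m i)"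
  by (intro eq_matI, simp_all add: diagonal_matrix_mult_index) (auto simp: diagonal_matrix_def)

lemma diagonal_matrix_adjoint: "(diagonal_matrix n l)\<^sup>\<dagger> = diagonal_matrix n (\<lambda>i. cnj (l i))"
  by (intro eq_matI) (auto simp: diagonal_matrix_def adjoint_index)

lemma spectral_mat_carrier [simp]: "unitary n U \<Longrightarrow> spectral_mat n U l \<in> carrier_mat n n"
  by (simp add: spectral_mat_def)

lemma spectral_mat_dim [simp]:
  "dim_row (spectral_mat n U l) = dim_row U" "dim_col (spectral_mat n U l) = dim_row U"
  by (simp_all add: spectral_mat_def)

lemma spectral_mat_mult:
  assumes "unitary n U"
  shows "spectral_mat n U l * spectral_mat n U m = spectral_mat n U (\<lambda>i. l i * m i)"
  using assms
  by (simp add: spectral_mat_def assoc_square flip: diagonal_matrix_mult)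

lemma spectral_mat_adjoint:
  assumes "unitary n U"
  shows "(spectral_mat n U l)\<^sup>\<dagger> = spectral_mat n U (\<lambda>i. cnj (l i))"
  using assms
  by (simp add: spectral_mat_def assoc_square adjoint_mult_square diagonal_matrix_adjoint)

lemma spectral_mat_const_1:
  assumes "unitary n U"
  shows "spectral_mat n U (\<lambda>i. 1) = 1\<^sub>m n"
proof -
  have "diagonal_matrix n (\<lambda>i. 1) = 1\<^sub>m n"
    by (intro eq_matI) (auto simp: diagonal_matrix_def)
  then show ?thesis
    using assms by (simp add: spectral_mat_def one_square)
qed

lemma mtrace_spectral_mat_mult:
  assumes "unitary n U" "A \<in> carrier_mat n n"
  shows "mtrace (spectral_mat n U l * A) = (\<Sum>i<n. l i * (U\<^sup>\<dagger> * A * U) $$ (i, i))"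
proof -
  have "mtrace (spectral_mat n U l * A) = mtrace (diagonal_matrix n l * (U\<^sup>\<dagger> * A * U))"
    using assms mtrace_comm_square[of U "diagonal_matrix n l * (U\<^sup>\<dagger> * A)"]
    by (simp add: spectral_mat_def assoc_square)
  also have "\<dots> = (\<Sum>i<n. l i * (U\<^sup>\<dagger> * A * U) $$ (i, i))"
    using assms unfolding mtrace_def
    by (intro sum.cong) (auto simp: diagonal_matrix_mult_index)
  finally show ?thesis .
qed

lemma mtrace_spectral_mat:
  assumes "unitary n U"
  shows "mtrace (spectral_mat n U l) = (\<Sum>i<n. l i)"
  using mtrace_spectral_mat_mult[OF assms, of "1\<^sub>m n" l] assms by (simp add: one_square)

lemma unitary_conj_spectral_mat:
  assumes "unitary n U" "A = spectral_mat n U l" "i < n"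
  shows "(U\<^sup>\<dagger> * A * U) $$ (i, i) = l i"
proof -
  have "U\<^sup>\<dagger> * A * U = diagonal_matrix n l"
    using assms by (simp add: spectral_mat_def assoc_square one_square)
  then show ?thesis
    using assms by (simp add: diagonal_matrix_def)
qed

text \<open>Functional calculus respects intertwiners: entrywise in the eigenbases the hypothesis says
  that \<open>(m i - l j) * T i j = 0\<close>. Both independence of the decomposition and commutation of
  functions of commuting matrices are instances.\<close>
lemma spectral_mat_intertwine:
  assumes U: "unitary n U" and V: "unitary n V" and T: "T \<in> carrier_mat n n"
    and eq: "spectral_mat n V m * T = T * spectral_mat n U l"
    and fg: "\<And>i j. i < n \<Longrightarrow> j < n \<Longrightarrow> m i = l j \<Longrightarrow> f i = g j"
  shows "spectral_mat n V f * T = T * spectral_mat n U g"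
proof -
  define S where "S = V\<^sup>\<dagger> * (T * U)"
  have S: "S \<in> carrier_mat n n"
    using U V T by (simp add: S_def)
  have *: "V\<^sup>\<dagger> * ((spectral_mat n V f * T) * U) = diagonal_matrix n f * S"
          "V\<^sup>\<dagger> * ((T * spectral_mat n U g) * U) = S * diagonal_matrix n g" for f g
    using U V T by (simp_all add: S_def spectral_mat_def assoc_square one_square)
  have "diagonal_matrix n m * S = S * diagonal_matrix n l"
    using *(1)[of m] *(2)[of l] eq by simp
  then have 1: "m i * S $$ (i, j) = S $$ (i, j) * l j" if "i < n" "j < n" for i j
    using diagonal_matrix_mult_index(1)[OF S that, of m] diagonal_matrix_mult_index(2)[OF S that, of l]
    by (simp only:)
  have 2: "f i * S $$ (i, j) = S $$ (i, j) * g j" if "i < n" "j < n" for i j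
  proof (cases "S $$ (i, j) = 0")
    case False
    then have "m i = l j"
      using 1[OF that] by (simp add: mult.commute)
    then show ?thesis
      using fg[OF that] by (simp add: mult.commute)
  qed simp
  have "diagonal_matrix n f * S = S * diagonal_matrix n g"
    using S by (intro eq_matI) (simp_all add: diagonal_matrix_mult_index 2)
  then have "V\<^sup>\<dagger> * ((spectral_mat n V f * T) * U) = V\<^sup>\<dagger> * ((T * spectral_mat n U g) * U)"
    by (simp only: *)
  then have "V * (V\<^sup>\<dagger> * ((spectral_mat n V f * T) * U)) * U\<^sup>\<dagger> = V * (V\<^sup>\<dagger> * ((T * spectral_mat n U g) * U)) * U\<^sup>\<dagger>"
    by (simp only:)
  then show ?thesis
    using U V T by (simp add: assoc_square one_square)
qed

text \<open>\<open>mpow\<close> evaluates whichever decomposition \<open>SOME\<close> picks. The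
  intertwining lemma with \<open>T\<close> the identity shows that any two real decompositions of
  \<open>A\<close> give the same power.\<close>

lemma mpow_spectral_mat:
  assumes U: "unitary n U" and A: "A = spectral_mat n U (\<lambda>i. complex_of_real (l i))"
  shows "mpow A p = spectral_mat n U (\<lambda>i. complex_of_real (l i powr p))"
proof -
  define P where "P = (\<lambda>(V, m). unitary n V \<and> A = V * diag_real n m * V\<^sup>\<dagger>)"
  have dim: "dim_row A = n"
    unfolding A by (rule carrier_matD(1)[OF spectral_mat_carrier[OF U]])
  have "P (U, l)"
    unfolding P_def diag_real_eq using U A[unfolded spectral_mat_def] by simp
  then have "P (SOME x. P x)"
    by (rule someI[of P])
  moreover obtain V m where Vm: "(SOME x. P x) = (V, m)"
    by (rule prod.exhaust)
  ultimately have "P (V, m)"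
    by (simp only:)
  then have V: "unitary n V" and AV: "A = spectral_mat n V (\<lambda>i. complex_of_real (m i))"
    unfolding P_def diag_real_eq spectral_mat_def by simp_all
  have "mpow A p = spectral_mat n V (\<lambda>i. complex_of_real (m i powr p))"
    unfolding mpow_def dim Let_def P_def[symmetric] Vm by (simp add: diag_real_eq spectral_mat_def)
  also have "\<dots> = spectral_mat n U (\<lambda>i. complex_of_real (l i powr p))"
    using spectral_mat_intertwine[OF U V one_carrier_mat, of "\<lambda>i. complex_of_real (m i)"
        "\<lambda>i. complex_of_real (l i)" "\<lambda>i. complex_of_real (m i powr p)" "\<lambda>i. complex_of_real (l i powr p)"]
      U V A AV by (simp add: one_square)
  finally show ?thesis .
qed

end

section \<open>The spectral theorem for normal matrices\<close>

lemma spectral_mat_index: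
  assumes "U \<in> carrier_mat n n" "i < n" "j < n"
  shows "spectral_mat n U l $$ (i, j) = (\<Sum>k<n. U $$ (i, k) * l k * cnj (U $$ (j, k)))"
  using assms unfolding spectral_mat_def
  by (subst index_square[of _ n]) (auto simp: diagonal_matrix_mult_index adjoint_index intro!: sum.cong)

lemma adjoint_mult_index:
  assumes "A \<in> carrier_mat n n" "B \<in> carrier_mat n n" "i < n" "j < n"
  shows "(A\<^sup>\<dagger> * B) $$ (i, j) = (\<Sum>k<n. cnj (A $$ (k, i)) * B $$ (k, j))"
    and "(A * B\<^sup>\<dagger>) $$ (i, j) = (\<Sum>k<n. A $$ (i, k) * cnj (B $$ (j, k)))"
  using assms by (subst index_square[of _ n]; auto simp: adjoint_index intro!: sum.cong)+

text \<open>Complete \<open>v\<close> to a basis and apply Gram-Schmidt, which keeps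
  \<open>v\<close> as the first vector. Dividing each vector by its norm gives the columns of
  \<open>U\<close>, and \<open>c\<close> is the inverse norm of \<open>v\<close>.\<close>

lemma unitary_completion:
  fixes v :: "complex Matrix.vec"
  assumes v: "v \<in> carrier_vec n" and v0: "v \<noteq> 0\<^sub>v n" and n: "0 < n"
  shows "\<exists>U c. unitary n U \<and> (\<forall>i<n. U $$ (i, 0) = c * vec_index v i)"
proof -
  interpret cof_vec_space n "TYPE(complex)" .
  define b where "b = basis_completion v"
  define ws where "ws = gram_schmidt n b"
  note bc = basis_completion[OF v v0, folded b_def]
  obtain vs where bv: "b = v # vs"
    using bc(6,7) n by (cases b) auto
  have ws: "set ws \<subseteq> carrier_vec n" "corthogonal ws" "length ws = n"
    using gram_schmidt_result[OF bc(2,4,5) refl, folded ws_def] bc(6) by auto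
  have hd: "ws ! 0 = v"
    using gram_schmidt_hd[OF v, of vs, folded bv ws_def] ws(3) n by (metis hd_conv_nth length_0_conv less_irrefl)
  define N where "N j = (\<Sum>k<n. (cmod (vec_index (ws ! j) k))\<^sup>2)" for j
  have sp: "scalar_prod (ws ! j) (conjugate (ws ! i)) = (\<Sum>k<n. cnj (vec_index (ws ! i) k) * vec_index (ws ! j) k)"
    if "i < n" "j < n" for i j
  proof -
    have "dim_vec (ws ! i) = n"
      using that ws(1,3) by (metis carrier_vecD nth_mem subsetD)
    then show ?thesis
      by (auto simp: scalar_prod_def lessThan_atLeast0 intro!: sum.cong)
  qed
  have NN: "(\<Sum>k<n. cnj (vec_index (ws ! i) k) * vec_index (ws ! i) k) = complex_of_real (N i)" for i
    unfolding N_def of_real_sum by (intro sum.cong refl) (metis complex_norm_square mult.commute of_real_power)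
  have N: "N i > 0" if "i < n" for i
  proof -
    have "N i \<noteq> 0"
      using corthogonalD[OF ws(2), of i i] that ws(3) sp[of i i] NN[of i] by auto
    moreover have "N i \<ge> 0"
      by (simp add: N_def sum_nonneg)
    ultimately show ?thesis
      by simp
  qed
  define U where "U = mat n n (\<lambda>(i, j). vec_index (ws ! j) i / complex_of_real (sqrt (N j)))"
  have U: "U \<in> carrier_mat n n"
    by (simp add: U_def)
  have "U\<^sup>\<dagger> * U = 1\<^sub>m n"
  proof (rule eq_matI)
    fix i j assume ij: "i < dim_row (1\<^sub>m n :: complex mat)" "j < dim_col (1\<^sub>m n :: complex mat)"
    have "(U\<^sup>\<dagger> * U) $$ (i, j) = (\<Sum>k<n. cnj (vec_index (ws ! i) k) * vec_index (ws ! j) k / complex_of_real (sqrt (N i) * sqrt (N j)))"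
      using ij U by (subst adjoint_mult_index[of _ n]) (auto simp: U_def intro!: sum.cong)
    also have "\<dots> = scalar_prod (ws ! j) (conjugate (ws ! i)) / complex_of_real (sqrt (N i) * sqrt (N j))"
      using ij sp[of i j] by (simp add: sum_divide_distrib)
    also have "\<dots> = 1\<^sub>m n $$ (i, j)"
    proof (cases "i = j")
      case True
      have "sqrt (N i) * sqrt (N i) = N i"
        using N[of i] ij by simp
      then show ?thesis
        using True N[of i] ij sp[of i i] NN[of i] by (simp del: real_sqrt_mult_self)
    next
      case False
      then show ?thesis
        using corthogonalD[OF ws(2), of j i] ij ws(3) by auto
    qed
    finally show "(U\<^sup>\<dagger> * U) $$ (i, j) = 1\<^sub>m n $$ (i, j)" .
  qed (use U in auto)
  then have "unitary n U"
    using U by (intro unitaryI)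
  moreover have "U $$ (i, 0) = 1 / complex_of_real (sqrt (N 0)) * vec_index v i" if "i < n" for i
    using that hd by (simp add: U_def)
  ultimately show ?thesis
    by blast
qed

text \<open>Induction on the dimension: rotating an eigenvector into the first coordinate clears the
  first column below the diagonal, normality then clears the rest of the first row, and the
  remaining block is again normal.\<close>

theorem normal_spectral_mat:
  assumes "A \<in> carrier_mat n n" "A\<^sup>\<dagger> * A = A * A\<^sup>\<dagger>"
  shows "\<exists>U l. unitary n U \<and> A = spectral_mat n U l"
  using assms
proof (induction n arbitrary: A)
  case 0
  have "unitary 0 (1\<^sub>m 0)"
    by (rule unitaryI) auto
  moreover have "A = spectral_mat 0 (1\<^sub>m 0) (\<lambda>_. 0)"
    using 0 \<open>unitary 0 (1\<^sub>m 0)\<close> by (intro eq_matI) auto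
  ultimately show ?case
    by blast
next
  case (Suc n)
  let ?N = "Suc n"
  note A = Suc.prems(1)
  obtain e v where "eigenvector A v e"
    using spectrum_non_empty[OF A] by (auto simp: spectrum_def eigenvalue_def)
  then have v: "v \<in> carrier_vec ?N" "v \<noteq> 0\<^sub>v ?N" and ev: "A *\<^sub>v v = e \<cdot>\<^sub>v v"
    using A by (auto simp: eigenvector_def)
  obtain U c where U: "unitary ?N U" and Uc: "\<And>i. i < ?N \<Longrightarrow> U $$ (i, 0) = c * vec_index v i"
    using unitary_completion[OF v] by auto
  have AU: "(A * U) $$ (i, 0) = e * U $$ (i, 0)" if "i < ?N" for i
  proof -
    have "(A * U) $$ (i, 0) = (\<Sum>k<?N. c * (A $$ (i, k) * vec_index v k))"
      using A U that Uc by (subst index_square[of _ ?N]) (auto simp del: sum.lessThan_Suc intro!: sum.cong)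
    also have "\<dots> = c * vec_index (A *\<^sub>v v) i"
      using A v that by (simp add: scalar_prod_def lessThan_atLeast0 sum_distrib_left del: sum.lessThan_Suc sum.op_ivl_Suc)
    finally show ?thesis
      using v that Uc by (simp add: ev)
  qed
  define B where "B = U\<^sup>\<dagger> * (A * U)"
  have B: "B \<in> carrier_mat ?N ?N"
    using A U by (simp add: B_def)
  have Bn: "B\<^sup>\<dagger> * B = B * B\<^sup>\<dagger>"
  proof -
    have "B\<^sup>\<dagger> * B = U\<^sup>\<dagger> * ((A\<^sup>\<dagger> * A) * U)" "B * B\<^sup>\<dagger> = U\<^sup>\<dagger> * ((A * A\<^sup>\<dagger>) * U)"
      using A U by (simp_all add: B_def adjoint_mult_square[of _ ?N] assoc_square[of _ ?N])
    then show ?thesis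
      using Suc.prems(2) by simp
  qed
  have col: "B $$ (i, 0) = (if i = 0 then e else 0)" if "i < ?N" for i
  proof -
    have "B $$ (i, 0) = e * (U\<^sup>\<dagger> * U) $$ (i, 0)"
      unfolding B_def using A U that AU
      by (subst (1 2) index_square[of _ ?N]) (auto simp: sum_distrib_left simp del: sum.lessThan_Suc intro!: sum.cong)
    then show ?thesis
      using U that by simp
  qed
  \<comment> \<open>Entry \<open>(0, 0)\<close> of the normality equation says that column 0 and row
    0 have the same norm. Column 0 contains only \<open>e\<close>, which is also the first entry of
    row 0, so nothing is left for the rest of the row.\<close>
  have row: "B $$ (0, Suc k) = 0" if "k < n" for k
  proof -
    have "(\<Sum>k<?N. (cmod (B $$ (k, 0)))\<^sup>2) = (\<Sum>k<?N. (cmod (B $$ (0, k)))\<^sup>2)"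
    proof -
      have "(\<Sum>k<?N. cnj (B $$ (k, 0)) * B $$ (k, 0)) = (\<Sum>k<?N. B $$ (0, k) * cnj (B $$ (0, k)))"
        using arg_cong[OF Bn, of "\<lambda>X. X $$ (0, 0)"] B by (simp add: adjoint_mult_index[of _ ?N] del: sum.lessThan_Suc)
      then have "complex_of_real (\<Sum>k<?N. (cmod (B $$ (k, 0)))\<^sup>2) = complex_of_real (\<Sum>k<?N. (cmod (B $$ (0, k)))\<^sup>2)"
        unfolding of_real_sum complex_norm_square by (simp only: mult.commute)
      then show ?thesis
        by (simp only: of_real_eq_iff)
    qed
    then have "(\<Sum>k<n. (cmod (B $$ (0, Suc k)))\<^sup>2) = 0"
      by (simp add: sum.lessThan_Suc_shift col del: sum.lessThan_Suc)
    then show ?thesis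
      using that by (simp add: sum_nonneg_eq_0_iff)
  qed
  define A1 where "A1 = mat n n (\<lambda>(i, j). B $$ (Suc i, Suc j))"
  have A1: "A1 \<in> carrier_mat n n"
    by (simp add: A1_def)
  have "A1\<^sup>\<dagger> * A1 = A1 * A1\<^sup>\<dagger>"
  proof (rule eq_matI)
    fix i j assume "i < dim_row (A1 * A1\<^sup>\<dagger>)" "j < dim_col (A1 * A1\<^sup>\<dagger>)"
    then have ij: "i < n" "j < n"
      using A1 by auto
    have "(B\<^sup>\<dagger> * B) $$ (Suc i, Suc j) = (A1\<^sup>\<dagger> * A1) $$ (i, j)"
      using A1 B ij row
      by (simp add: adjoint_mult_index[of _ ?N] adjoint_mult_index[of _ n] sum.lessThan_Suc_shift A1_def del: sum.lessThan_Suc)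
    moreover have "(B * B\<^sup>\<dagger>) $$ (Suc i, Suc j) = (A1 * A1\<^sup>\<dagger>) $$ (i, j)"
      using A1 B ij col
      by (simp add: adjoint_mult_index[of _ ?N] adjoint_mult_index[of _ n] sum.lessThan_Suc_shift A1_def del: sum.lessThan_Suc)
    ultimately show "(A1\<^sup>\<dagger> * A1) $$ (i, j) = (A1 * A1\<^sup>\<dagger>) $$ (i, j)"
      using Bn by simp
  qed (use A1 in auto)
  then obtain V l where V: "unitary n V" and A1V: "A1 = spectral_mat n V l"
    using Suc.IH[OF A1] by blast
  have Vc: "V \<in> carrier_mat n n"
    using V by simp
  \<comment> \<open>The direct sum of the number 1 and \<open>V\<close>; below, \<open>l'\<close>
    prepends \<open>e\<close> to \<open>l\<close> accordingly.\<close>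
  define V' where "V' = mat ?N ?N (\<lambda>(i, j). if i = 0 \<or> j = 0 then (if i = j then 1 else 0) else V $$ (i - 1, j - 1))"
  have V'c: "V' \<in> carrier_mat ?N ?N"
    by (simp add: V'_def)
  have "V'\<^sup>\<dagger> * V' = 1\<^sub>m ?N"
  proof (rule eq_matI)
    fix i j assume "i < dim_row (1\<^sub>m ?N :: complex mat)" "j < dim_col (1\<^sub>m ?N :: complex mat)"
    then have ij: "i < ?N" "j < ?N"
      by auto
    have *: "(\<Sum>k<n. cnj (V $$ (k, i)) * V $$ (k, j)) = (if i = j then 1 else 0)" if "i < n" "j < n" for i j
      using adjoint_mult_index(1)[OF Vc Vc that] V that by simp
    show "(V'\<^sup>\<dagger> * V') $$ (i, j) = 1\<^sub>m ?N $$ (i, j)"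
      using ij V'c by (cases i; cases j) (simp_all add: adjoint_mult_index[of _ ?N] sum.lessThan_Suc_shift V'_def * del: sum.lessThan_Suc)
  qed (use V'c in auto)
  then have V': "unitary ?N V'"
    using V'c by (intro unitaryI)
  define l' where "l' = case_nat e l"
  have "B = spectral_mat ?N V' l'"
  proof (rule eq_matI)
    fix i j assume "i < dim_row (spectral_mat ?N V' l')" "j < dim_col (spectral_mat ?N V' l')"
    then have ij: "i < ?N" "j < ?N"
      using V'c by auto
    have *: "B $$ (Suc i, Suc j) = (\<Sum>k<n. V $$ (i, k) * l k * cnj (V $$ (j, k)))" if "i < n" "j < n" for i j
      using arg_cong[OF A1V, of "\<lambda>X. X $$ (i, j)"] that by (simp add: A1_def spectral_mat_index[OF Vc])
    show "B $$ (i, j) = spectral_mat ?N V' l' $$ (i, j)"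
      using ij V'c col row
      by (cases i; cases j) (simp_all add: spectral_mat_index sum.lessThan_Suc_shift V'_def l'_def * del: sum.lessThan_Suc)
  qed (use B V'c in auto)
  moreover have "A = U * (B * U\<^sup>\<dagger>)"
    using A U by (simp add: B_def assoc_square[of _ ?N] one_square)
  ultimately have "A = spectral_mat ?N (U * V') l'"
    using U V' by (simp add: spectral_mat_def adjoint_mult_square[of _ ?N] assoc_square[of _ ?N])
  then show ?case
    using unitary_mult[OF U V'] by blast
qed

lemma spectral_mat_cong:
  "(\<And>i. i < n \<Longrightarrow> l i = m i) \<Longrightarrow> spectral_mat n U l = spectral_mat n U m"
proof -
  assume "\<And>i. i < n \<Longrightarrow> l i = m i"
  then have "diagonal_matrix n l = diagonal_matrix n m"
    by (intro eq_matI) (auto simp: diagonal_matrix_def)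
  then show ?thesis
    by (simp only: spectral_mat_def)
qed

lemma hermitian_spectral_mat:
  assumes A: "A \<in> carrier_mat n n" and h: "hermitian A"
  obtains U l where "unitary n U" "A = spectral_mat n U (\<lambda>i. complex_of_real (l i))"
proof -
  obtain U l where U: "unitary n U" and l: "A = spectral_mat n U l"
    using normal_spectral_mat[OF A] h by (auto simp: hermitian_def)
  have l': "A = spectral_mat n U (\<lambda>i. cnj (l i))"
    using spectral_mat_adjoint[OF U, of l] l h by (simp add: hermitian_def)
  have "l i = complex_of_real (Re (l i))" if "i < n" for i
    using unitary_conj_spectral_mat[OF U l that] unitary_conj_spectral_mat[OF U l' that]
    by (simp add: complex_eq_iff)
  then have "A = spectral_mat n U (\<lambda>i. complex_of_real (Re (l i)))"
    unfolding l by (intro spectral_mat_cong)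
  then show ?thesis
    by (rule that[OF U])
qed

text \<open>For commuting Hermitian \<open>A\<close> and \<open>B\<close> the matrix
  \<open>A + \<i> B\<close> is normal. Its adjoint \<open>A - \<i> B\<close> is diagonal in the same
  basis with conjugate eigenvalues, so \<open>A\<close> and \<open>B\<close> carry their real and
  imaginary parts.\<close>

lemma commuting_hermitian_spectral_mat:
  assumes A: "A \<in> carrier_mat n n" "hermitian A" and B: "B \<in> carrier_mat n n" "hermitian B"
    and AB: "A * B = B * A"
  obtains W a b where "unitary n W" "A = spectral_mat n W (\<lambda>i. complex_of_real (a i))"
    "B = spectral_mat n W (\<lambda>i. complex_of_real (b i))"
proof -
  have hA: "cnj (A $$ (i, j)) = A $$ (j, i)" if "i < n" "j < n" for i j
    using arg_cong[OF A(2)[unfolded hermitian_def], of "\<lambda>X. X $$ (j, i)"] A(1) that by (simp add: adjoint_index)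
  have hB: "cnj (B $$ (i, j)) = B $$ (j, i)" if "i < n" "j < n" for i j
    using arg_cong[OF B(2)[unfolded hermitian_def], of "\<lambda>X. X $$ (j, i)"] B(1) that by (simp add: adjoint_index)
  define N where "N = mat n n (\<lambda>(i, j). A $$ (i, j) + \<i> * B $$ (i, j))"
  have N: "N \<in> carrier_mat n n"
    by (simp add: N_def)
  have "N\<^sup>\<dagger> * N = N * N\<^sup>\<dagger>"
  proof (rule eq_matI)
    fix i j assume "i < dim_row (N * N\<^sup>\<dagger>)" "j < dim_col (N * N\<^sup>\<dagger>)"
    then have ij: "i < n" "j < n"
      using N by auto
    have "(\<Sum>k<n. A $$ (i, k) * B $$ (k, j)) = (\<Sum>k<n. B $$ (i, k) * A $$ (k, j))"
      using arg_cong[OF AB, of "\<lambda>X. X $$ (i, j)"] A(1) B(1) ij by (simp add: index_square[of _ n])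
    then show "(N\<^sup>\<dagger> * N) $$ (i, j) = (N * N\<^sup>\<dagger>) $$ (i, j)"
      using N ij by (simp add: adjoint_mult_index[of _ n] N_def hA hB algebra_simps sum.distrib sum_subtractf
          flip: sum_distrib_left)
  qed (use N in auto)
  then obtain W l where W: "unitary n W" and l: "N = spectral_mat n W l"
    using normal_spectral_mat[OF N] by blast
  have l': "N\<^sup>\<dagger> = spectral_mat n W (\<lambda>i. cnj (l i))"
    using l spectral_mat_adjoint[OF W] by simp
  have Nl: "A $$ (i, j) + \<i> * B $$ (i, j) = (\<Sum>k<n. W $$ (i, k) * l k * cnj (W $$ (j, k)))" if "i < n" "j < n" for i j
    using arg_cong[OF l, of "\<lambda>X. X $$ (i, j)"] W that by (simp add: spectral_mat_index N_def)
  have Nl': "A $$ (i, j) - \<i> * B $$ (i, j) = (\<Sum>k<n. W $$ (i, k) * cnj (l k) * cnj (W $$ (j, k)))" if "i < n" "j < n" for i j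
    using arg_cong[OF l', of "\<lambda>X. X $$ (i, j)"] W N that by (simp add: spectral_mat_index N_def adjoint_index hA hB)
  have "A = spectral_mat n W (\<lambda>i. complex_of_real (Re (l i)))"
  proof (rule eq_matI)
    fix i j assume "i < dim_row (spectral_mat n W (\<lambda>i. complex_of_real (Re (l i))))"
      "j < dim_col (spectral_mat n W (\<lambda>i. complex_of_real (Re (l i))))"
    then have ij: "i < n" "j < n"
      using W by auto
    have "2 * A $$ (i, j) = (\<Sum>k<n. W $$ (i, k) * (l k + cnj (l k)) * cnj (W $$ (j, k)))"
      using Nl[OF ij] Nl'[OF ij] by (simp add: algebra_simps sum.distrib)
    also have "\<dots> = 2 * spectral_mat n W (\<lambda>i. complex_of_real (Re (l i))) $$ (i, j)"
      using W ij by (simp add: spectral_mat_index complex_add_cnj sum_distrib_left mult_ac)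
    finally show "A $$ (i, j) = spectral_mat n W (\<lambda>i. complex_of_real (Re (l i))) $$ (i, j)"
      by simp
  qed (use A W in auto)
  moreover have "B = spectral_mat n W (\<lambda>i. complex_of_real (Im (l i)))"
  proof (rule eq_matI)
    fix i j assume "i < dim_row (spectral_mat n W (\<lambda>i. complex_of_real (Im (l i))))"
      "j < dim_col (spectral_mat n W (\<lambda>i. complex_of_real (Im (l i))))"
    then have ij: "i < n" "j < n"
      using W by auto
    have "2 * \<i> * B $$ (i, j) = (\<Sum>k<n. W $$ (i, k) * (l k - cnj (l k)) * cnj (W $$ (j, k)))"
      using Nl[OF ij] Nl'[OF ij] by (simp add: algebra_simps sum_subtractf)
    also have "\<dots> = 2 * \<i> * spectral_mat n W (\<lambda>i. complex_of_real (Im (l i))) $$ (i, j)"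
      using W ij by (simp add: spectral_mat_index complex_diff_cnj sum_distrib_left mult_ac)
    finally show "B $$ (i, j) = spectral_mat n W (\<lambda>i. complex_of_real (Im (l i))) $$ (i, j)"
      by simp
  qed (use B W in auto)
  ultimately show ?thesis
    by (rule that[OF W])
qed

section \<open>Positive matrices\<close>

lemma unitary_conj_index:
  assumes U: "unitary n U" and A: "A \<in> carrier_mat n n" and i: "i < n"
  shows "(U\<^sup>\<dagger> * A * U) $$ (i, i) = scalar_prod (conjugate (col U i)) (A *\<^sub>v col U i)"
proof -
  have U': "U \<in> carrier_mat n n"
    using U by simp
  have "(U\<^sup>\<dagger> * A * U) $$ (i, i) = (U\<^sup>\<dagger> * (A * U)) $$ (i, i)"
    using U' A by (simp add: assoc_square[of _ n])
  also have "\<dots> = scalar_prod (Matrix.row (U\<^sup>\<dagger>) i) (col (A * U) i)"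
    using U' A i by (subst index_mult_mat(1)) auto
  also have "col (A * U) i = A *\<^sub>v col U i"
    using U' A i by (intro col_mult2) auto
  also have "Matrix.row (U\<^sup>\<dagger>) i = conjugate (col U i)"
    using U' i by (simp add: mat_adjoint_def)
  finally show ?thesis .
qed

lemma unitary_col_nonzero:
  assumes U: "unitary n U" and i: "i < n"
  shows "col U i \<noteq> 0\<^sub>v n"
proof
  assume "col U i = 0\<^sub>v n"
  then have "U $$ (k, i) = 0" if "k < n" for k
    using U i that index_col[of k U i] by simp
  moreover have "(U\<^sup>\<dagger> * U) $$ (i, i) = 1"
    using U i by simp
  ultimately show False
    using adjoint_mult_index(1)[of U n U i i] U i by simp
qed

lemma diag_in_psd:
  assumes U: "unitary n U" and A: "psd n A" and i: "i < n"
  shows "(U\<^sup>\<dagger> * A * U) $$ (i, i) = complex_of_real (diag_in U A i)" "0 \<le> diag_in U A i"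
proof -
  have "col U i \<in> carrier_vec n"
    using U col_dim[of U i] by simp
  then have "0 \<le> (U\<^sup>\<dagger> * A * U) $$ (i, i)"
    using A unfolding psd_def by (subst unitary_conj_index[OF U _ i]) auto
  then show "(U\<^sup>\<dagger> * A * U) $$ (i, i) = complex_of_real (diag_in U A i)" "0 \<le> diag_in U A i"
    by (auto simp: diag_in_def less_eq_complex_def complex_eq_iff)
qed

lemma pd_imp_psd: "pd n A \<Longrightarrow> psd n A"
proof -
  assume A: "pd n A"
  have "0 \<le> scalar_prod (conjugate v) (A *\<^sub>v v)" if "v \<in> carrier_vec n" for v
  proof (cases "v = 0\<^sub>v n")
    case True
    then show ?thesis
      using A by (auto simp: pd_def scalar_prod_def)
  next
    case False
    then show ?thesis
      using A that by (auto simp: pd_def less_imp_le)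
  qed
  then show ?thesis
    using A by (simp add: pd_def psd_def)
qed

lemma diag_in_pd:
  assumes U: "unitary n U" and A: "pd n A" and i: "i < n"
  shows "(U\<^sup>\<dagger> * A * U) $$ (i, i) = complex_of_real (diag_in U A i)" "0 < diag_in U A i"
proof -
  have "col U i \<in> carrier_vec n"
    using U col_dim[of U i] by simp
  then have "0 < (U\<^sup>\<dagger> * A * U) $$ (i, i)"
    using A unitary_col_nonzero[OF U i] unfolding pd_def by (subst unitary_conj_index[OF U _ i]) auto
  then show "(U\<^sup>\<dagger> * A * U) $$ (i, i) = complex_of_real (diag_in U A i)" "0 < diag_in U A i"
    by (auto simp: diag_in_def less_complex_def complex_eq_iff)
qed

lemma psd_spectral_mat:
  assumes "psd n A"
  obtains U l where "unitary n U" "A = spectral_mat n U (\<lambda>i. complex_of_real (l i))" "\<And>i. i < n \<Longrightarrow> 0 \<le> l i"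
proof -
  obtain U l where U: "unitary n U" and l: "A = spectral_mat n U (\<lambda>i. complex_of_real (l i))"
    using assms by (auto simp: psd_def elim: hermitian_spectral_mat)
  have "0 \<le> l i" if "i < n" for i
    using diag_in_psd[OF U assms that] unitary_conj_spectral_mat[OF U l that] by simp
  then show ?thesis
    using U l that by blast
qed

lemma pd_spectral_mat:
  assumes "pd n A"
  obtains U l where "unitary n U" "A = spectral_mat n U (\<lambda>i. complex_of_real (l i))" "\<And>i. i < n \<Longrightarrow> 0 < l i"
proof -
  obtain U l where U: "unitary n U" and l: "A = spectral_mat n U (\<lambda>i. complex_of_real (l i))"
    using assms by (auto simp: pd_def elim: hermitian_spectral_mat)
  have "0 < l i" if "i < n" for i
    using diag_in_pd[OF U assms that] unitary_conj_spectral_mat[OF U l that] by simp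
  then show ?thesis
    using U l that by blast
qed

text \<open>In the eigenbasis of \<open>M\<close> the trace sums the nonnegative eigenvalues of
  \<open>M\<close> times strictly positive diagonal entries of \<open>R\<close>, and so vanishes
  only if every eigenvalue does. Consequently a nonzero effect has positive probability.\<close>

lemma mtrace_psd_pd:
  assumes M: "psd n M" and R: "pd n R"
  shows "mtrace (M * R) = complex_of_real (Re (mtrace (M * R)))" "0 \<le> Re (mtrace (M * R))"
    "Re (mtrace (M * R)) = 0 \<Longrightarrow> M = 0\<^sub>m n n"
proof -
  have Rc: "R \<in> carrier_mat n n"
    using R by (simp add: pd_def)
  obtain U l where U: "unitary n U" and l: "M = spectral_mat n U (\<lambda>i. complex_of_real (l i))" "\<And>i. i < n \<Longrightarrow> 0 \<le> l i"
    using psd_spectral_mat[OF M] by blast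
  have tr: "mtrace (M * R) = complex_of_real (\<Sum>i<n. l i * diag_in U R i)"
    using mtrace_spectral_mat_mult[OF U Rc, of "\<lambda>i. complex_of_real (l i)"] diag_in_pd(1)[OF U R]
    by (simp add: l(1))
  have nn: "0 \<le> l i * diag_in U R i" if "i \<in> {..<n}" for i
    using l(2)[of i] diag_in_pd(2)[OF U R, of i] that by simp
  show "mtrace (M * R) = complex_of_real (Re (mtrace (M * R)))" "0 \<le> Re (mtrace (M * R))"
    unfolding tr using nn by (auto intro: sum_nonneg)
  show "M = 0\<^sub>m n n" if "Re (mtrace (M * R)) = 0"
  proof -
    have "(\<Sum>i<n. l i * diag_in U R i) = 0"
      using that unfolding tr Re_complex_of_real .
    then have "l i * diag_in U R i = 0" if "i < n" for i
      using nn that sum_nonneg_eq_0_iff[of "{..<n}" "\<lambda>i. l i * diag_in U R i"] by auto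
    then have "l i = 0" if "i < n" for i
      using diag_in_pd(2)[OF U R that] that by fastforce
    then show ?thesis
      using U unfolding l(1) by (intro eq_matI) (simp_all add: spectral_mat_index)
  qed
qed

text \<open>The eigenvalue \<open>x i\<close> is the squared norm of column \<open>i\<close> of
  \<open>G * V\<close>, and a matrix with a left inverse has no zero column.\<close>

lemma gram_spectral_mat:
  assumes G: "G \<in> carrier_mat n n" and H: "H \<in> carrier_mat n n" "H * G = 1\<^sub>m n"
  obtains V x where "unitary n V" "G\<^sup>\<dagger> * G = spectral_mat n V (\<lambda>i. complex_of_real (x i))" "\<And>i. i < n \<Longrightarrow> 0 < x i"
proof -
  have "hermitian (G\<^sup>\<dagger> * G)"
    using G by (simp add: hermitian_def adjoint_mult_square[of _ n])
  then obtain V x where V: "unitary n V" and x: "G\<^sup>\<dagger> * G = spectral_mat n V (\<lambda>i. complex_of_real (x i))"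
    using G hermitian_spectral_mat[of "G\<^sup>\<dagger> * G" n] by auto
  have "0 < x i" if i: "i < n" for i
  proof -
    define K where "K = G * V"
    have K: "K \<in> carrier_mat n n"
      using G V by (simp add: K_def)
    have "V\<^sup>\<dagger> * (G\<^sup>\<dagger> * G) * V = K\<^sup>\<dagger> * K"
      using G V by (simp add: K_def adjoint_mult_square[of _ n] assoc_square[of _ n])
    then have "complex_of_real (x i) = (\<Sum>k<n. cnj (K $$ (k, i)) * K $$ (k, i))"
      using unitary_conj_spectral_mat[OF V x i] adjoint_mult_index(1)[OF K K i i] by simp
    also have "\<dots> = complex_of_real (\<Sum>k<n. (cmod (K $$ (k, i)))\<^sup>2)"
      unfolding of_real_sum complex_norm_square by (simp only: mult.commute)
    finally have xi: "x i = (\<Sum>k<n. (cmod (K $$ (k, i)))\<^sup>2)"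
      by (simp only: of_real_eq_iff)
    moreover have "x i \<noteq> 0"
    proof
      assume "x i = 0"
      then have z: "K $$ (k, i) = 0" if "k < n" for k
        using xi that by (simp add: sum_nonneg_eq_0_iff)
      have HK: "(V\<^sup>\<dagger> * H) * K = 1\<^sub>m n"
        using G H V assoc_square[of H n G V] by (simp add: K_def assoc_square[of _ n] one_square)
      have "((V\<^sup>\<dagger> * H) * K) $$ (i, i) = 0"
        using V H K i z by (subst index_square[of _ n]) simp_all
      then show False
        using HK i by simp
    qed
    ultimately show ?thesis
      by (metis less_eq_real_def sum_nonneg zero_le_power2)
  qed
  then show ?thesis
    using V x that by blast
qed

section \<open>The three lines theorem\<close>

definition strip :: "complex set" where
  "strip = {z. 0 \<le> Re z \<and> Re z \<le> 1}"

text \<open>The functions that occur are sums of products of exponentials, so holomorphy is asked on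
  the whole plane: continuity up to the edges is then immediate, and the maximum principle yields
  constancy on the edges too.\<close>

definition strip_fun :: "(complex \<Rightarrow> complex) \<Rightarrow> bool" where
  "strip_fun h \<longleftrightarrow> h holomorphic_on UNIV \<and> bounded (h ` strip)"

lemma strip_fun_const [intro]: "strip_fun (\<lambda>z. c)"
  by (auto simp: strip_fun_def image_constant_conv)

lemma strip_fun_mult [intro]:
  assumes "strip_fun f" "strip_fun g"
  shows "strip_fun (\<lambda>z. f z * g z)"
proof -
  obtain A B where "\<And>z. z \<in> strip \<Longrightarrow> cmod (f z) \<le> A" "\<And>z. z \<in> strip \<Longrightarrow> cmod (g z) \<le> B"
    using assms by (force simp: strip_fun_def bounded_iff)
  then have "cmod (f z * g z) \<le> A * B" if "z \<in> strip" for z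
    using that unfolding norm_mult by (intro mult_mono) (auto intro: order_trans[OF norm_ge_zero])
  then show ?thesis
    using assms by (auto simp: strip_fun_def bounded_iff intro!: holomorphic_intros)
qed

lemma strip_fun_add:
  assumes "strip_fun f" "strip_fun g"
  shows "strip_fun (\<lambda>z. f z + g z)"
  using assms unfolding strip_fun_def
  by (auto intro!: holomorphic_intros bounded_plus_comp)

lemma strip_fun_sum [intro]:
  assumes "\<And>j. j \<in> J \<Longrightarrow> strip_fun (f j)"
  shows "strip_fun (\<lambda>z. \<Sum>j\<in>J. f j z)"
  using assms by (induction J rule: infinite_finite_induct) (auto intro: strip_fun_add)

text \<open>The coefficients are real, so the modulus depends on \<open>Re z\<close> only.\<close>

lemma strip_fun_exp:
  "strip_fun (\<lambda>z. exp ((complex_of_real a + complex_of_real b * z) * complex_of_real c))"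
proof -
  have "cmod (exp ((complex_of_real a + complex_of_real b * z) * complex_of_real c)) \<le> exp (\<bar>a * c\<bar> + \<bar>b * c\<bar>)"
    if "z \<in> strip" for z
  proof -
    have "b * c * Re z \<le> \<bar>b * c * Re z\<bar>"
      by (rule abs_ge_self)
    also have "\<dots> = \<bar>b * c\<bar> * Re z"
      using that by (simp add: abs_mult strip_def)
    also have "\<dots> \<le> \<bar>b * c\<bar>"
      using that by (simp add: strip_def mult_left_le)
    finally have "b * c * Re z \<le> \<bar>b * c\<bar>" .
    then have "(a + b * Re z) * c \<le> \<bar>a * c\<bar> + \<bar>b * c\<bar>"
      using abs_ge_self[of "a * c"] by (simp add: algebra_simps)
    then show ?thesis
      by (simp add: norm_exp_eq_Re)
  qed
  then show ?thesis
    by (auto simp: strip_fun_def bounded_iff intro!: holomorphic_intros)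
qed

text \<open>Multiplication by \<open>exp (\<epsilon> * (z\<^sup>2 - 1))\<close> makes the function decay at \<open>\<plusminus>\<i>\<infinity>\<close>, so that
  the maximum principle applies on long rectangles.\<close>
lemma strip_max_modulus:
  assumes h: "strip_fun h"
    and b0: "\<And>z. Re z = 0 \<Longrightarrow> cmod (h z) \<le> K" and b1: "\<And>z. Re z = 1 \<Longrightarrow> cmod (h z) \<le> K"
    and K: "0 < K" and z: "z \<in> strip"
  shows "cmod (h z) \<le> K"
proof -
  obtain B where B: "\<And>z. z \<in> strip \<Longrightarrow> cmod (h z) \<le> B"
    using h by (force simp: strip_fun_def bounded_iff)
  have hol: "h holomorphic_on UNIV"
    using h by (simp add: strip_fun_def)
  have B0: "0 \<le> B"
    using B[OF z] by (auto intro: order_trans[OF norm_ge_zero])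
  have *: "cmod (h z * exp (complex_of_real e * (z\<^sup>2 - 1))) \<le> K" if e: "e > 0" for e
  proof -
    define g where "g = (\<lambda>z. h z * exp (complex_of_real e * (z\<^sup>2 - 1)))"
    have ng: "cmod (g w) \<le> cmod (h w) * exp (- e * (Im w)\<^sup>2)" if "w \<in> strip" for w
    proof -
      have "(Re w)\<^sup>2 \<le> 1"
        using that by (auto simp: strip_def power_le_one)
      then have "e * ((Re w)\<^sup>2 - (Im w)\<^sup>2 - 1) \<le> - e * (Im w)\<^sup>2"
        using e by (auto simp: algebra_simps)
      then show ?thesis
        by (auto simp: g_def norm_mult norm_exp_eq_Re Re_power2 intro!: mult_left_mono)
    qed
    \<comment> \<open>\<open>R\<close> is large enough for \<open>z\<close> to lie inside the
      rectangle. Moreover \<open>R \<ge> 1\<close> gives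
      \<open>B \<le> K * e * R \<le> K * exp (e * R\<^sup>2)\<close>, so the damping factor brings
      the bound \<open>B\<close> below \<open>K\<close> on the horizontal edges.\<close>
    define R where "R = \<bar>Im z\<bar> + 1 + B / (K * e)"
    have R: "R > \<bar>Im z\<bar>" "1 \<le> R" "B / (K * e) \<le> R"
      using B0 K e by (auto simp: R_def intro: add_pos_nonneg)
    have "B \<le> K * e * R"
      using R(3) K e by (simp add: field_simps)
    also have "\<dots> \<le> K * (e * R\<^sup>2)"
      using R(2) K e by (simp add: power2_eq_square mult_left_le)
    also have "\<dots> \<le> K * exp (e * R\<^sup>2)"
      using K exp_ge_add_one_self[of "e * R\<^sup>2"] by (intro mult_left_mono) linarith+
    finally have BR: "B * exp (- e * R\<^sup>2) \<le> K"
      by (simp add: exp_minus field_simps)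
    define S where "S = cbox (Complex 0 (-R)) (Complex 1 R)"
    have S: "w \<in> S \<longleftrightarrow> 0 \<le> Re w \<and> Re w \<le> 1 \<and> -R \<le> Im w \<and> Im w \<le> R" for w
      by (auto simp: S_def in_cbox_complex_iff)
    have fr: "cmod (g w) \<le> K" if "w \<in> frontier S" for w
    proof -
      have wS: "w \<in> S" "w \<notin> box (Complex 0 (-R)) (Complex 1 R)"
        using that by (auto simp: S_def frontier_def interior_cbox closure_cbox)
      then have st: "w \<in> strip"
        by (auto simp: S strip_def)
      consider "Re w = 0" | "Re w = 1" | "(Im w)\<^sup>2 = R\<^sup>2"
        using wS R by (fastforce simp: S in_box_complex_iff power2_eq_iff)
      then show ?thesis
      proof cases
        case 3
        have "cmod (g w) \<le> B * exp (- e * R\<^sup>2)"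
          using ng[OF st] B[OF st] unfolding 3
          by (meson exp_ge_zero mult_right_mono order_trans)
        then show ?thesis
          using BR by simp
      qed (use ng[OF st] b0[of w] b1[of w] e in \<open>auto intro!: order_trans[OF ng[OF st]] order_trans[OF mult_left_le]\<close>)
    qed
    have zS: "z \<in> S"
      using z R by (auto simp: S strip_def)
    have "g holomorphic_on UNIV"
      unfolding g_def by (intro holomorphic_intros hol)
    then have hg: "g holomorphic_on interior S" "continuous_on (closure S) g"
      by (meson holomorphic_on_imp_continuous_on holomorphic_on_subset subset_UNIV)+
    have bS: "bounded S"
      by (simp add: S_def)
    have "cmod (g z) \<le> K"
      by (rule maximum_modulus_frontier[OF hg bS fr zS])
    then show ?thesis
      by (simp add: g_def)
  qed
  have "((\<lambda>e. cmod (h z * exp (complex_of_real e * (z\<^sup>2 - 1)))) \<longlongrightarrow> cmod (h z * exp (complex_of_real 0 * (z\<^sup>2 - 1)))) (at_right 0)"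
    by (intro tendsto_intros)
  then have "cmod (h z * exp (complex_of_real 0 * (z\<^sup>2 - 1))) \<le> K"
    by (rule tendsto_upperbound) (use * in \<open>auto simp: eventually_at_filter\<close>)
  then show ?thesis
    by simp
qed

lemma strip_three_lines:
  assumes h: "strip_fun h" and "0 < A" "0 < B"
    and b0: "\<And>z. Re z = 0 \<Longrightarrow> cmod (h z) \<le> A" and b1: "\<And>z. Re z = 1 \<Longrightarrow> cmod (h z) \<le> B"
    and t: "0 \<le> t" "t \<le> 1"
  shows "cmod (h (complex_of_real t)) \<le> A powr (1 - t) * B powr t"
proof -
  \<comment> \<open>The extra factor is \<open>A^(z-1) * B^(-z)\<close>, which normalises the bounds
    on both edges to 1.\<close>
  define k where "k = (\<lambda>z. h z * exp ((complex_of_real (- ln A) + complex_of_real (ln A - ln B) * z) * complex_of_real 1))"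
  have nk: "cmod (k z) = cmod (h z) * exp (- (1 - Re z) * ln A - Re z * ln B)" for z
    by (simp add: k_def norm_mult norm_exp_eq_Re algebra_simps)
  have "cmod (k (complex_of_real t)) \<le> 1"
  proof (rule strip_max_modulus[of k])
    show "strip_fun k"
      unfolding k_def by (intro strip_fun_mult strip_fun_exp h)
    show "cmod (k z) \<le> 1" if "Re z = 0" for z
      using b0[OF that] assms that by (simp add: nk exp_minus field_simps)
    show "cmod (k z) \<le> 1" if "Re z = 1" for z
      using b1[OF that] assms that by (simp add: nk exp_minus field_simps)
  qed (use t in \<open>auto simp: strip_def\<close>)
  then have "cmod (h (complex_of_real t)) \<le> exp ((1 - t) * ln A + t * ln B)"
    by (simp add: nk exp_diff exp_minus exp_add left_diff_distrib field_simps)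
  then show ?thesis
    using assms by (simp add: powr_def exp_add)
qed

text \<open>The modulus attains its maximum over the open strip at the interior point
  \<open>t\<close>, so the maximum principle makes the entire function \<open>h\<close> constant on
  the plane.\<close>

lemma strip_max_modulus_eq:
  assumes h: "strip_fun h"
    and b0: "\<And>z. Re z = 0 \<Longrightarrow> cmod (h z) \<le> K" and b1: "\<And>z. Re z = 1 \<Longrightarrow> cmod (h z) \<le> K"
    and K: "0 < K" and t: "0 < t" "t < 1" and eq: "h (complex_of_real t) = complex_of_real K"
  shows "h z = complex_of_real K"
proof -
  have "h constant_on UNIV"
  proof (rule maximum_modulus_principle)
    show "open {z. 0 < Re z \<and> Re z < 1}"
      by (intro open_Collect_conj open_halfspace_Re_gt open_halfspace_Re_lt)
    show "cmod (h z) \<le> cmod (h (complex_of_real t))" if "z \<in> {z. 0 < Re z \<and> Re z < 1}" for z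
      using strip_max_modulus[OF h b0 b1 K, of z] that K by (simp add: eq strip_def)
  qed (use h t in \<open>auto simp: strip_fun_def\<close>)
  then show ?thesis
    using eq by (metis UNIV_I constant_on_def)
qed

text \<open>By Cauchy-Schwarz the pairing of \<open>c\<close> with \<open>y\<close> has modulus at
  most \<open>sqrt (C * A)\<close> and \<open>sqrt (C * B)\<close> on the two edges, and the three
  lines theorem interpolates. In the equality case the pairing is constantly \<open>C\<close>, so
  Cauchy-Schwarz is an equality on the edges and pins \<open>y\<close> down there.\<close>

lemma three_lines_pairing:
  fixes c :: "'j \<Rightarrow> complex" and y :: "'j \<Rightarrow> complex \<Rightarrow> complex"
  assumes y: "\<And>j. j \<in> J \<Longrightarrow> strip_fun (y j)"
    and C: "(\<Sum>j\<in>J. (cmod (c j))\<^sup>2) = C" "0 < C"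
    and A: "\<And>z. Re z = 0 \<Longrightarrow> (\<Sum>j\<in>J. (cmod (y j z))\<^sup>2) = A" "0 < A"
    and B: "\<And>z. Re z = 1 \<Longrightarrow> (\<Sum>j\<in>J. (cmod (y j z))\<^sup>2) = B" "0 < B"
  shows three_lines_pairing_le: "0 \<le> t \<Longrightarrow> t \<le> 1 \<Longrightarrow>
      (cmod (\<Sum>j\<in>J. c j * y j (complex_of_real t)))\<^sup>2 \<le> C * (A powr (1 - t) * B powr t)"
    and three_lines_pairing_eq: "0 < t \<Longrightarrow> t < 1 \<Longrightarrow> A = C \<Longrightarrow> B = C \<Longrightarrow>
      (\<Sum>j\<in>J. c j * y j (complex_of_real t)) = complex_of_real C \<Longrightarrow>
      Re z = 0 \<or> Re z = 1 \<Longrightarrow> j \<in> J \<Longrightarrow> y j z = cnj (c j)"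
proof -
  define h where "h = (\<lambda>z. \<Sum>j\<in>J. c j * y j z)"
  have h: "strip_fun h"
    unfolding h_def using y by (intro strip_fun_sum strip_fun_mult strip_fun_const)
  \<comment> \<open>A sum over an infinite set is 0, so \<open>C > 0\<close> excludes an infinite
    \<open>J\<close>.\<close>
  have fin: "finite J"
    using C by (auto intro: ccontr)
  have cs: "cmod (h z) \<le> sqrt (C * D)" if "(\<Sum>j\<in>J. (cmod (y j z))\<^sup>2) = D" for z D
  proof -
    have "cmod (h z) \<le> (\<Sum>j\<in>J. cmod (c j) * cmod (y j z))"
      unfolding h_def by (rule sum_norm_le) (simp add: norm_mult)
    moreover have "(\<Sum>j\<in>J. cmod (c j) * cmod (y j z))\<^sup>2 \<le> C * D"
      using Cauchy_Schwarz_ineq_sum[of "\<lambda>j. cmod (c j)" "\<lambda>j. cmod (y j z)" J] C(1) that by simp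
    ultimately show ?thesis
      by (meson norm_ge_zero order_trans real_le_rsqrt)
  qed
  note b0 = cs[OF A(1)] and b1 = cs[OF B(1)]
  show "(cmod (\<Sum>j\<in>J. c j * y j (complex_of_real t)))\<^sup>2 \<le> C * (A powr (1 - t) * B powr t)"
    if t: "0 \<le> t" "t \<le> 1"
  proof -
    have "cmod (h (complex_of_real t)) \<le> sqrt (C * A) powr (1 - t) * sqrt (C * B) powr t"
      using A B C t by (intro strip_three_lines[OF h _ _ b0 b1]) auto
    then have "(cmod (h (complex_of_real t)))\<^sup>2 \<le> (sqrt (C * A) powr (1 - t) * sqrt (C * B) powr t)\<^sup>2"
      by (intro power_mono) auto
    also have "\<dots> = (C * A) powr (1 - t) * (C * B) powr t"
      using A B C by (simp add: power_mult_distrib powr_half_sqrt[symmetric] powr_powr powr_power diff_divide_distrib)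
    also have "\<dots> = C * (A powr (1 - t) * B powr t)"
      using A B C by (simp add: powr_mult powr_diff)
    finally show ?thesis
      by (simp add: h_def)
  qed
  show "y j z = cnj (c j)"
    if t: "0 < t" "t < 1" and AC: "A = C" "B = C" and eq: "(\<Sum>j\<in>J. c j * y j (complex_of_real t)) = complex_of_real C"
      and z: "Re z = 0 \<or> Re z = 1" and j: "j \<in> J"
  proof -
    have "h z = complex_of_real C"
    proof (rule strip_max_modulus_eq[OF h _ _ C(2) t])
      show "cmod (h z) \<le> C" if "Re z = 0" for z
        using b0[OF that] C(2) AC by simp
      show "cmod (h z) \<le> C" if "Re z = 1" for z
        using b1[OF that] C(2) AC by simp
    qed (use eq in \<open>simp add: h_def\<close>)
    then have "(\<Sum>j\<in>J. Re (c j * y j z)) = C"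
      using Re_sum[of "\<lambda>j. c j * y j z" J] by (simp only: h_def Re_complex_of_real)
    \<comment> \<open>Summed over \<open>J\<close>, the right-hand side is
      \<open>C + C - 2 * C = 0\<close>.\<close>
    moreover have "(cmod (y j z - cnj (c j)))\<^sup>2 = (cmod (y j z))\<^sup>2 + (cmod (c j))\<^sup>2 - 2 * Re (c j * y j z)" for j
      unfolding cmod_power2 by (simp add: power2_eq_square algebra_simps)
    moreover have "(\<Sum>j\<in>J. (cmod (y j z))\<^sup>2) = C"
      using z A(1) B(1) AC by auto
    ultimately have "(\<Sum>j\<in>J. (cmod (y j z - cnj (c j)))\<^sup>2) = 0"
      using C(1) by (simp add: sum.distrib sum_subtractf flip: sum_distrib_left)
    then show ?thesis
      using j fin by (simp add: sum_nonneg_eq_0_iff)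
  qed
qed

section \<open>Maximisation over the unitary group\<close>

text \<open>Tychonoff's theorem for the product topology on functions.\<close>

lemma compact_Pi_UNIV:
  fixes S :: "'i \<Rightarrow> 'a::topological_space set"
  assumes "\<And>i. compact (S i)"
  shows "compact (Pi UNIV S)"
proof -
  have "compactin (product_topology (\<lambda>i. euclidean) UNIV) (Pi\<^sub>E UNIV S)"
    using assms by (simp add: compactin_PiE)
  then show ?thesis
    by (simp add: euclidean_product_topology PiE_UNIV_domain)
qed

lemma unitary_entry_le_1:
  assumes "unitary n U" "i < n" "j < n"
  shows "cmod (U $$ (i, j)) \<le> 1"
proof -
  have "complex_of_real (\<Sum>k<n. (cmod (U $$ (k, j)))\<^sup>2) = (\<Sum>k<n. cnj (U $$ (k, j)) * U $$ (k, j))"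
    unfolding of_real_sum complex_norm_square by (simp only: mult.commute)
  also have "\<dots> = (U\<^sup>\<dagger> * U) $$ (j, j)"
    using assms by (simp add: adjoint_mult_index[of _ n] del: unitary_cancel)
  also have "\<dots> = complex_of_real 1"
    using assms by simp
  finally have "(\<Sum>k<n. (cmod (U $$ (k, j)))\<^sup>2) = 1"
    by (simp only: of_real_eq_iff)
  then have "(cmod (U $$ (i, j)))\<^sup>2 \<le> 1"
    using member_le_sum[of i "{..<n}" "\<lambda>k. (cmod (U $$ (k, j)))\<^sup>2"] assms by simp
  then show ?thesis
    by (simp add: abs_square_le_1)
qed

lemma unitary_mat_iff:
  "unitary n (mat n n \<phi>) \<longleftrightarrow> (\<forall>i\<in>{..<n}. \<forall>j\<in>{..<n}. (\<Sum>k<n. cnj (\<phi> (k, i)) * \<phi> (k, j)) = (if i = j then 1 else 0))"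
proof -
  have c: "mat n n \<phi> \<in> carrier_mat n n"
    by simp
  have ix: "((mat n n \<phi>)\<^sup>\<dagger> * mat n n \<phi>) $$ (i, j) = (\<Sum>k<n. cnj (\<phi> (k, i)) * \<phi> (k, j))" if "i < n" "j < n" for i j
    using that by (simp add: adjoint_mult_index(1)[OF c c])
  show ?thesis
  proof
    assume "unitary n (mat n n \<phi>)"
    then have "((mat n n \<phi>)\<^sup>\<dagger> * mat n n \<phi>) $$ (i, j) = (if i = j then 1 else 0)" if "i < n" "j < n" for i j
      using that by simp
    then show "\<forall>i\<in>{..<n}. \<forall>j\<in>{..<n}. (\<Sum>k<n. cnj (\<phi> (k, i)) * \<phi> (k, j)) = (if i = j then 1 else 0)"
      using ix by simp
  next
    assume *: "\<forall>i\<in>{..<n}. \<forall>j\<in>{..<n}. (\<Sum>k<n. cnj (\<phi> (k, i)) * \<phi> (k, j)) = (if i = j then 1 else 0)"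
    have "(mat n n \<phi>)\<^sup>\<dagger> * mat n n \<phi> = 1\<^sub>m n"
      by (rule eq_matI) (use * ix in auto)
    then show "unitary n (mat n n \<phi>)"
      using c by (intro unitaryI)
  qed
qed

text \<open>Matrices are parametrised by entry functions \<open>\<phi>\<close> under the product
  topology. Unitarity is a closed condition on them, and bounding every coordinate by 1, as the
  entries of a unitary matrix are, makes the set \<open>K\<close> compact.\<close>

lemma unitary_attains_sup:
  fixes g :: "complex mat \<Rightarrow> real"
  assumes g: "continuous_on {\<phi>. unitary n (mat n n \<phi>)} (\<lambda>\<phi>. g (mat n n \<phi>))"
  obtains W where "unitary n W" "\<And>W'. unitary n W' \<Longrightarrow> g W' \<le> g W"
proof -
  define K where "K = Pi UNIV (\<lambda>_ :: nat \<times> nat. cball (0::complex) 1) \<inter> {\<phi>. unitary n (mat n n \<phi>)}"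
  have co: "continuous_on UNIV (\<lambda>\<phi> :: nat \<times> nat \<Rightarrow> complex. \<phi> p)" for p
    by (rule continuous_on_product_coordinates)
  have "closed {\<phi> :: nat \<times> nat \<Rightarrow> complex. (\<Sum>k<n. cnj (\<phi> (k, i)) * \<phi> (k, j)) = (if i = j then 1 else 0)}" for i j
    by (intro closed_Collect_eq continuous_intros co)
  then have "closed (\<Inter>i\<in>{..<n}. \<Inter>j\<in>{..<n}. {\<phi> :: nat \<times> nat \<Rightarrow> complex. (\<Sum>k<n. cnj (\<phi> (k, i)) * \<phi> (k, j)) = (if i = j then 1 else 0)})"
    by (intro closed_INT ballI)
  also have "(\<Inter>i\<in>{..<n}. \<Inter>j\<in>{..<n}. {\<phi> :: nat \<times> nat \<Rightarrow> complex. (\<Sum>k<n. cnj (\<phi> (k, i)) * \<phi> (k, j)) = (if i = j then 1 else 0)})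
      = {\<phi>. unitary n (mat n n \<phi>)}"
    unfolding unitary_mat_iff by blast
  finally have "compact K"
    unfolding K_def by (intro compact_Int_closed compact_Pi_UNIV) auto
  have ext: "\<exists>\<phi>\<in>K. mat n n \<phi> = W" if W: "unitary n W" for W
  proof -
    \<comment> \<open>Coordinates outside the \<open>n\<close> by \<open>n\<close> block do not
      affect the matrix; the value 0 keeps them in the unit disc.\<close>
    define \<phi> where "\<phi> = (\<lambda>(i, j). if i < n \<and> j < n then W $$ (i, j) else 0)"
    have "mat n n \<phi> = W"
      using W by (intro eq_matI) (auto simp: \<phi>_def)
    then have "\<phi> \<in> K"
      using W by (auto simp: K_def \<phi>_def unitary_entry_le_1)
    then show ?thesis
      using \<open>mat n n \<phi> = W\<close> by blast
  qed
  have "unitary n (1\<^sub>m n)"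
    by (rule unitaryI) (auto intro!: eq_matI simp: adjoint_index)
  then have "K \<noteq> {}"
    using ext by blast
  moreover have "continuous_on K (\<lambda>\<phi>. g (mat n n \<phi>))"
    using g by (rule continuous_on_subset) (auto simp: K_def)
  ultimately obtain \<phi> where \<phi>: "\<phi> \<in> K" "\<And>\<psi>. \<psi> \<in> K \<Longrightarrow> g (mat n n \<psi>) \<le> g (mat n n \<phi>)"
    using continuous_attains_sup[OF \<open>compact K\<close>] by blast
  have "g W' \<le> g (mat n n \<phi>)" if "unitary n W'" for W'
    using ext[OF that] \<phi>(2) by blast
  then show ?thesis
    using that \<phi>(1) by (auto simp: K_def)
qed

lemma continuous_on_diag_in:
  assumes A: "A \<in> carrier_mat n n" and i: "i < n"
  shows "continuous_on S (\<lambda>\<phi>. diag_in (mat n n \<phi>) A i)"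
proof -
  have co: "continuous_on S (\<lambda>\<phi> :: nat \<times> nat \<Rightarrow> complex. \<phi> p)" for p
    by (rule continuous_on_subset[OF continuous_on_product_coordinates]) simp
  have "diag_in (mat n n \<phi>) A i = Re (\<Sum>j<n. (\<Sum>k<n. cnj (\<phi> (k, i)) * A $$ (k, j)) * \<phi> (j, i))" for \<phi>
    using A i unfolding diag_in_def
    by (subst index_square[of _ n]) (simp_all add: adjoint_mult_index(1)[of _ n])
  then show ?thesis
    by (simp only:) (intro continuous_intros co)
qed

section \<open>Complex powers of positive matrices\<close>

text \<open>The complex power of the matrix with eigenvalues \<open>l > 0\<close>. Taking the
  decomposition as argument makes every entry entire in \<open>z\<close> and turns addition of
  exponents into matrix multiplication.\<close>

definition cpow_mat :: "nat \<Rightarrow> complex mat \<Rightarrow> (nat \<Rightarrow> real) \<Rightarrow> complex \<Rightarrow> complex mat" where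
  "cpow_mat n U l z = spectral_mat n U (\<lambda>i. exp (z * complex_of_real (ln (l i))))"

definition strip_mat :: "nat \<Rightarrow> (complex \<Rightarrow> complex mat) \<Rightarrow> bool" where
  "strip_mat n F \<longleftrightarrow> (\<forall>z. F z \<in> carrier_mat n n) \<and> (\<forall>i<n. \<forall>j<n. strip_fun (\<lambda>z. F z $$ (i, j)))"

lemma cpow_mat_carrier [simp]: "unitary n U \<Longrightarrow> cpow_mat n U l z \<in> carrier_mat n n"
  by (simp add: cpow_mat_def)

lemma cpow_mat_mult:
  assumes "unitary n U"
  shows "cpow_mat n U l z * cpow_mat n U l z' = cpow_mat n U l (z + z')"
    and "A \<in> carrier_mat n n \<Longrightarrow> cpow_mat n U l z * (cpow_mat n U l z' * A) = cpow_mat n U l (z + z') * A"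
proof -
  show *: "cpow_mat n U l z * cpow_mat n U l z' = cpow_mat n U l (z + z')"
    by (simp add: cpow_mat_def spectral_mat_mult[OF assms] exp_add[symmetric] algebra_simps)
  show "A \<in> carrier_mat n n \<Longrightarrow> cpow_mat n U l z * (cpow_mat n U l z' * A) = cpow_mat n U l (z + z') * A"
    using assms assoc_square[of "cpow_mat n U l z" n "cpow_mat n U l z'" A] by (simp add: *)
qed

lemma cpow_mat_0: "unitary n U \<Longrightarrow> cpow_mat n U l 0 = 1\<^sub>m n"
  by (simp add: cpow_mat_def spectral_mat_const_1)

lemma cpow_mat_adjoint: "unitary n U \<Longrightarrow> (cpow_mat n U l z)\<^sup>\<dagger> = cpow_mat n U l (cnj z)"
  by (simp add: cpow_mat_def spectral_mat_adjoint exp_cnj)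

lemma cpow_mat_of_real:
  assumes "\<And>i. i < n \<Longrightarrow> 0 < l i"
  shows "cpow_mat n U l (complex_of_real p) = spectral_mat n U (\<lambda>i. complex_of_real (l i powr p))"
  unfolding cpow_mat_def
proof (rule spectral_mat_cong)
  fix i assume "i < n"
  then show "exp (complex_of_real p * complex_of_real (ln (l i))) = complex_of_real (l i powr p)"
    using assms[of i] by (simp add: powr_def exp_of_real flip: of_real_mult)
qed

lemma cpow_mat_1:
  assumes "\<And>i. i < n \<Longrightarrow> 0 < l i"
  shows "cpow_mat n U l 1 = spectral_mat n U (\<lambda>i. complex_of_real (l i))"
proof -
  have "cpow_mat n U l 1 = spectral_mat n U (\<lambda>i. complex_of_real (l i powr 1))"
    using cpow_mat_of_real[of n l U 1] assms by simp
  also have "\<dots> = spectral_mat n U (\<lambda>i. complex_of_real (l i))"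
    using assms by (intro spectral_mat_cong) (simp add: abs_of_pos)
  finally show ?thesis .
qed

lemma mpow_eq_cpow_mat:
  assumes "unitary n U" "\<And>i. i < n \<Longrightarrow> 0 < l i"
  shows "mpow (spectral_mat n U (\<lambda>i. complex_of_real (l i))) p = cpow_mat n U l (complex_of_real p)"
  using mpow_spectral_mat[OF assms(1) refl] cpow_mat_of_real[OF assms(2)] by simp

section \<open>Matrix-valued functions on the strip\<close>

lemma strip_mat_cpow:
  assumes "unitary n U" "\<And>z. f z = complex_of_real a + complex_of_real b * z"
  shows "strip_mat n (\<lambda>z. cpow_mat n U l (f z))"
proof -
  have "strip_fun (\<lambda>z. cpow_mat n U l (f z) $$ (i, j))" if "i < n" "j < n" for i j
    using assms that unfolding cpow_mat_def
    by (simp add: spectral_mat_index strip_fun_sum strip_fun_mult strip_fun_const strip_fun_exp)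
  then show ?thesis
    using assms by (simp add: strip_mat_def)
qed

lemma strip_mat_mult:
  assumes "strip_mat n F" "strip_mat n G"
  shows "strip_mat n (\<lambda>z. F z * G z)"
proof -
  have "strip_fun (\<lambda>z. (F z * G z) $$ (i, j))" if "i < n" "j < n" for i j
  proof -
    have "strip_fun (\<lambda>z. \<Sum>k<n. F z $$ (i, k) * G z $$ (k, j))"
      using assms that by (intro strip_fun_sum strip_fun_mult) (auto simp: strip_mat_def)
    then show ?thesis
      using assms that by (simp add: index_square[of _ n] strip_mat_def)
  qed
  then show ?thesis
    using assms by (simp add: strip_mat_def)
qed

lemma strip_mat_const: "A \<in> carrier_mat n n \<Longrightarrow> strip_mat n (\<lambda>z. A)"
  by (simp add: strip_mat_def strip_fun_const)

text \<open>The pairing lemma for all matrix entries at once; reading \<open>Z x z\<close>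
  transposed turns the pairing into a sum of traces. The index set \<open>I\<close> is a single
  point in the comparison with the sandwiched quantity and the set of outcomes in the reduction of
  POVMs.\<close>

lemma matrix_three_lines:
  fixes C :: "'x \<Rightarrow> complex mat" and Z :: "'x \<Rightarrow> complex \<Rightarrow> complex mat"
  assumes C: "\<And>x. x \<in> I \<Longrightarrow> C x \<in> carrier_mat n n" and Z: "\<And>x. x \<in> I \<Longrightarrow> strip_mat n (Z x)"
    and c: "(\<Sum>x\<in>I. hs (C x)) = c" "0 < c"
    and A: "\<And>z. Re z = 0 \<Longrightarrow> (\<Sum>x\<in>I. hs (Z x z)) = A" "0 < A"
    and B: "\<And>z. Re z = 1 \<Longrightarrow> (\<Sum>x\<in>I. hs (Z x z)) = B" "0 < B"
  shows matrix_three_lines_le: "0 \<le> t \<Longrightarrow> t \<le> 1 \<Longrightarrow>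
      (cmod (\<Sum>x\<in>I. mtrace (C x * Z x (complex_of_real t))))\<^sup>2 \<le> c * (A powr (1 - t) * B powr t)"
    and matrix_three_lines_eq: "0 < t \<Longrightarrow> t < 1 \<Longrightarrow> A = c \<Longrightarrow> B = c \<Longrightarrow>
      (\<Sum>x\<in>I. mtrace (C x * Z x (complex_of_real t))) = complex_of_real c \<Longrightarrow>
      Re z = 0 \<or> Re z = 1 \<Longrightarrow> x \<in> I \<Longrightarrow> Z x z = (C x)\<^sup>\<dagger>"
proof -
  define J where "J = I \<times> ({..<n} \<times> {..<n})"
  define cc where "cc = (\<lambda>(x, i, j). C x $$ (i, j))"
  define y where "y = (\<lambda>(x, i, j) z. Z x z $$ (j, i))"
  have Zc: "Z x z \<in> carrier_mat n n" if "x \<in> I" for x z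
    using Z[OF that] by (simp add: strip_mat_def)
  have J: "(\<Sum>(x, i, j)\<in>J. g x i j) = (\<Sum>x\<in>I. \<Sum>i<n. \<Sum>j<n. g x i j)"
    for g :: "'x \<Rightarrow> nat \<Rightarrow> nat \<Rightarrow> 'b::comm_monoid_add"
    by (simp add: J_def sum.cartesian_product)
  have 1: "(\<Sum>j\<in>J. (cmod (cc j))\<^sup>2) = (\<Sum>x\<in>I. hs (C x))"
  proof -
    have "(\<Sum>j\<in>J. (cmod (cc j))\<^sup>2) = (\<Sum>(x, i, j)\<in>J. (cmod (C x $$ (i, j)))\<^sup>2)"
      by (intro sum.cong) (auto simp: cc_def)
    also have "\<dots> = (\<Sum>x\<in>I. hs (C x))"
      unfolding J by (intro sum.cong refl) (simp add: hs_def carrier_matD[OF C])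
    finally show ?thesis .
  qed
  have 2: "(\<Sum>j\<in>J. (cmod (y j z))\<^sup>2) = (\<Sum>x\<in>I. hs (Z x z))" for z
  proof -
    have "(\<Sum>j\<in>J. (cmod (y j z))\<^sup>2) = (\<Sum>(x, i, j)\<in>J. (cmod (Z x z $$ (j, i)))\<^sup>2)"
      by (intro sum.cong) (auto simp: y_def)
    also have "\<dots> = (\<Sum>x\<in>I. hs (Z x z))"
      unfolding J
    proof (intro sum.cong refl)
      fix x assume "x \<in> I"
      then have "hs (Z x z) = (\<Sum>i<n. \<Sum>j<n. (cmod (Z x z $$ (i, j)))\<^sup>2)"
        using Zc[of x z] by (simp add: hs_def)
      also have "\<dots> = (\<Sum>i<n. \<Sum>j<n. (cmod (Z x z $$ (j, i)))\<^sup>2)"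
        by (rule sum.swap)
      finally show "(\<Sum>i<n. \<Sum>j<n. (cmod (Z x z $$ (j, i)))\<^sup>2) = hs (Z x z)"
        by simp
    qed
    finally show ?thesis .
  qed
  have 3: "(\<Sum>j\<in>J. cc j * y j z) = (\<Sum>x\<in>I. mtrace (C x * Z x z))" for z
  proof -
    have "(\<Sum>j\<in>J. cc j * y j z) = (\<Sum>(x, i, j)\<in>J. C x $$ (i, j) * Z x z $$ (j, i))"
      by (intro sum.cong) (auto simp: cc_def y_def)
    also have "\<dots> = (\<Sum>x\<in>I. mtrace (C x * Z x z))"
      unfolding J by (intro sum.cong refl) (simp add: mtrace_square[OF C Zc])
    finally show ?thesis .
  qed
  have y: "strip_fun (y j)" if "j \<in> J" for j
    using that Z by (auto simp: J_def y_def strip_mat_def)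
  show "(cmod (\<Sum>x\<in>I. mtrace (C x * Z x (complex_of_real t))))\<^sup>2 \<le> c * (A powr (1 - t) * B powr t)"
    if "0 \<le> t" "t \<le> 1"
    by (rule three_lines_pairing_le[of J y cc c A B, unfolded 1 2 3]) (fact y c A B that)+
  show "Z x z = (C x)\<^sup>\<dagger>"
    if t: "0 < t" "t < 1" and AB: "A = c" "B = c"
      and eq: "(\<Sum>x\<in>I. mtrace (C x * Z x (complex_of_real t))) = complex_of_real c"
      and z: "Re z = 0 \<or> Re z = 1" and x: "x \<in> I"
  proof (rule eq_matI)
    fix i j assume "i < dim_row ((C x)\<^sup>\<dagger>)" "j < dim_col ((C x)\<^sup>\<dagger>)"
    then have ij: "i < n" "j < n"
      using C[OF x] by auto
    then have "y (x, j, i) z = cnj (cc (x, j, i))"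
      by (intro three_lines_pairing_eq[of J y cc c A B, unfolded 1 2 3, OF y c A B t AB eq z])
        (use x in \<open>auto simp: J_def\<close>)
    then show "Z x z $$ (i, j) = (C x)\<^sup>\<dagger> $$ (i, j)"
      using C[OF x] ij by (simp add: y_def cc_def adjoint_index)
  qed (use C[OF x] Zc[OF x] in auto)
qed

section \<open>Comparison with the sandwiched quantity\<close>

text \<open>Here \<open>U, s\<close> decompose \<sigma>, \<open>V, x\<close> the sandwiched matrix
  \<open>X\<close>, and \<open>W, w\<close> the matrix \<omega>. In \<open>f1\<close> the operator
  \<rho> is written as \<open>\<sigma>^(b/2) X \<sigma>^(b/2)\<close>, so \<open>f1\<close> and
  \<open>f2\<close> are the two evaluations of \<open>f\<close>.\<close>

context
  fixes n :: nat and U V W :: "complex mat" and s x w :: "nat \<Rightarrow> real" and \<alpha> b f Q :: real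
  assumes U: "unitary n U" and V: "unitary n V" and W: "unitary n W"
    and \<alpha>: "1/2 < \<alpha>" "\<alpha> \<noteq> 1" and b: "b = (\<alpha> - 1) / \<alpha>"
    and f1: "mtrace (cpow_mat n U s (b / 2) * (cpow_mat n V x 1 * (cpow_mat n U s (b / 2) * cpow_mat n W w b))) = complex_of_real f"
    and f2: "mtrace (cpow_mat n U s 1 * cpow_mat n W w 1) = complex_of_real f"
    and Q: "mtrace (cpow_mat n V x \<alpha>) = complex_of_real Q"
    and pos: "0 < f" "0 < Q"
begin

private abbreviation (input) "S \<equiv> cpow_mat n U s"
private abbreviation (input) "X \<equiv> cpow_mat n V x"
private abbreviation (input) "\<Omega> \<equiv> cpow_mat n W w"

private definition "C = X (1/2) * (S (b / 2) * \<Omega> (b / 2))"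
private definition Z :: "complex \<Rightarrow> complex mat" where
  "Z z = \<Omega> (z / 2) * (S (z / 2) * X (complex_of_real \<alpha> * (1 - z) / 2))"

private lemmas ms = cpow_mat_mult[OF U] cpow_mat_mult[OF V] cpow_mat_mult[OF W]
  cpow_mat_adjoint[OF U] cpow_mat_adjoint[OF V] cpow_mat_adjoint[OF W]
  cpow_mat_0[OF U] cpow_mat_0[OF V] cpow_mat_0[OF W] U V W
  assoc_square[of _ n] adjoint_mult_square[of _ n] one_square[of _ n]

private lemma C: "C \<in> carrier_mat n n"
  using U V W by (simp add: C_def)

private lemma Z: "strip_mat n Z"
  unfolding Z_def
proof (intro strip_mat_mult strip_mat_cpow U V W)
  show "z / 2 = complex_of_real 0 + complex_of_real (1/2) * z" for z by simp
  show "z / 2 = complex_of_real 0 + complex_of_real (1/2) * z" for z by simp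
  show "complex_of_real \<alpha> * (1 - z) / 2 = complex_of_real (\<alpha>/2) + complex_of_real (-\<alpha>/2) * z" for z
    by (simp add: field_simps)
qed

private lemma hs_C: "hs C = f"
proof -
  have "complex_of_real (hs C) = mtrace (C * C\<^sup>\<dagger>)"
    using hs_eq_mtrace[of "C\<^sup>\<dagger>"] by (simp add: hs_adjoint)
  also have "C * C\<^sup>\<dagger> = X (1/2) * (S (b / 2) * (\<Omega> b * (S (b / 2) * X (1/2))))"
    by (simp add: C_def ms)
  also have "mtrace \<dots> = mtrace (S (b / 2) * (\<Omega> b * (S (b / 2) * X 1)))"
    by (subst mtrace_comm_square[of _ n]) (simp_all add: ms)
  also have "\<dots> = mtrace ((S (b / 2) * X 1) * (S (b / 2) * \<Omega> b))"
    using mtrace_comm_square[of "S (b / 2) * \<Omega> b" n "S (b / 2) * X 1"] by (simp add: ms)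
  also have "\<dots> = complex_of_real f"
    using f1 by (simp add: ms)
  finally show ?thesis
    by (simp only: of_real_eq_iff)
qed

text \<open>For imaginary \<open>z\<close> the powers of \<omega> and \<sigma> in \<open>Z z\<close>
  are unitary and cancel against their adjoints, leaving \<open>X^\<alpha>\<close>.\<close>

private lemma hs_Z0: "hs (Z z) = Q" if "Re z = 0"
proof -
  have *: "cnj z = - z"
    using that by (simp add: complex_eq_iff)
  have "complex_of_real (hs (Z z)) = mtrace (X \<alpha>)"
    by (simp add: hs_eq_mtrace Z_def ms *) (simp add: field_simps)
  then show ?thesis
    by (simp only: Q of_real_eq_iff)
qed

text \<open>Now the power of \<open>X\<close> is unitary. Cyclicity of the trace removes it and
  joins the two powers of \<sigma>, whose exponents \<open>cnj z / 2\<close> and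
  \<open>z / 2\<close> add up to 1.\<close>

private lemma hs_Z1: "hs (Z z) = f" if "Re z = 1"
proof -
  have *: "cnj z = 2 - z"
    using that by (simp add: complex_eq_iff)
  have **: "(2 - z) / 2 + z / 2 = 1"
    by (simp add: field_simps)
  have "complex_of_real (hs (Z z)) = mtrace (X (\<alpha> * (z - 1) / 2) * (S ((2 - z) / 2) * (\<Omega> 1 * (S (z / 2) * X (\<alpha> * (1 - z) / 2)))))"
    by (simp add: hs_eq_mtrace Z_def ms * **)
  also have "\<dots> = mtrace (S ((2 - z) / 2) * (\<Omega> 1 * S (z / 2)))"
    by (subst mtrace_comm_square[of _ n]) (simp_all add: ms, simp_all add: algebra_simps ms flip: add_divide_distrib)
  also have "\<dots> = mtrace (S 1 * \<Omega> 1)"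
    using mtrace_comm_square[of "S ((2 - z) / 2) * \<Omega> 1" n "S (z / 2)"] ** by (simp add: ms add.commute)
  finally show ?thesis
    by (simp only: f2 of_real_eq_iff)
qed

text \<open>Since \<open>\<alpha> * (1 - b) = 1\<close>, the value of \<open>Z\<close> at
  \<open>b\<close> is the adjoint of \<open>C\<close>, and the trace is \<open>hs C\<close>.\<close>

private lemma trace_b: "mtrace (C * Z b) = complex_of_real f"
proof -
  have "complex_of_real \<alpha> * (1 - complex_of_real b) / 2 = 1 / 2"
    using \<alpha> by (simp add: b field_simps)
  then have "C * Z b = C * C\<^sup>\<dagger>"
    by (simp add: C_def Z_def ms)
  then show ?thesis
    using hs_eq_mtrace[of "C\<^sup>\<dagger>"] hs_C by (simp add: hs_adjoint)
qed

text \<open>The powers of \<omega> and \<sigma> in the two factors cancel, and the exponents of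
  \<open>X\<close> add up to \<open>1/2 + \<alpha> * (1 + b) / 2 = \<alpha>\<close>.\<close>

private lemma trace_minus_b: "mtrace (C * Z (- complex_of_real b)) = complex_of_real Q"
proof -
  have "1 / 2 + complex_of_real \<alpha> * (1 + complex_of_real b) / 2 = complex_of_real \<alpha>"
    using \<alpha> by (simp add: b field_simps)
  then have "C * Z (- complex_of_real b) = X \<alpha>"
    by (simp add: C_def Z_def ms)
  then show ?thesis
    by (simp add: Q)
qed

private lemma tl_le:
  assumes "0 \<le> t" "t \<le> 1"
  shows "(cmod (mtrace (C * Z (complex_of_real t))))\<^sup>2 \<le> f * (Q powr (1 - t) * f powr t)"
  using matrix_three_lines_le[of "{()}" "\<lambda>_. C" n "\<lambda>_. Z" f Q f t] assms C Z pos
  by (simp add: hs_C hs_Z0 hs_Z1)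

private lemma tl_eq:
  assumes "f = Q" "0 < t" "t < 1" "mtrace (C * Z (complex_of_real t)) = complex_of_real f" "Re z = 0 \<or> Re z = 1"
  shows "Z z = C\<^sup>\<dagger>"
  using matrix_three_lines_eq[of "{()}" "\<lambda>_. C" n "\<lambda>_. Z" f f f t z "()"] assms C Z pos hs_Z0
  by (simp add: hs_C hs_Z1)

text \<open>At \<open>t = b\<close> the three lines bound reads
  \<open>f^2 \<le> f * Q^(1-b) * f^b\<close>.\<close>

lemma sandwich_gt_1:
  assumes "1 < \<alpha>"
  shows "f \<le> Q"
proof -
  have b01: "0 < b" "b < 1"
    using assms by (auto simp: b field_simps)
  have "(cmod (mtrace (C * Z b)))\<^sup>2 \<le> f * (Q powr (1 - b) * f powr b)"
    using b01 by (intro tl_le) auto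
  then have "f * f \<le> f * (Q powr (1 - b) * f powr b)"
    using pos by (simp add: trace_b power2_eq_square)
  then have "f \<le> Q powr (1 - b) * f powr b"
    using pos by simp
  then have "f powr (1 - b) \<le> Q powr (1 - b)"
    using pos by (simp add: powr_diff field_simps)
  then show ?thesis
    using pos b01 powr_less_mono2[of "1 - b" Q f] by fastforce
qed

text \<open>Now \<open>b\<close> is negative, and \<alpha> > 1/2 is exactly what puts
  \<open>-b\<close> below 1. At \<open>t = -b\<close> the bound reads
  \<open>Q^2 \<le> f * Q^(1+b) * f^(-b)\<close>.\<close>

lemma sandwich_lt_1:
  assumes "\<alpha> < 1"
  shows "Q \<le> f"
proof -
  have b01: "0 < - b" "- b < 1"
    using assms \<alpha> by (auto simp: b field_simps)
  have "(cmod (mtrace (C * Z (complex_of_real (- b)))))\<^sup>2 \<le> f * (Q powr (1 - (- b)) * f powr (- b))"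
    using b01 by (intro tl_le) auto
  then have "Q * Q \<le> f * (Q powr (1 - (- b)) * f powr (- b))"
    using pos by (simp add: trace_minus_b power2_eq_square)
  then have "Q powr (1 - b) \<le> f powr (1 - b)"
    using pos by (simp add: powr_diff powr_add powr_minus field_simps)
  then show ?thesis
    using pos b01 powr_less_mono2[of "1 - b" f Q] by fastforce
qed

text \<open>At the interior point, \<open>b\<close> or \<open>-b\<close> according to its sign, the
  pairing takes the extremal value \<open>f = Q\<close>. Hence \<open>Z 0\<close> and
  \<open>Z 1\<close>, the two sides of the claim, both equal the adjoint of
  \<open>C\<close>.\<close>

lemma sandwich_eq:
  assumes "f = Q"
  shows "X (\<alpha> / 2) = \<Omega> (1 / 2) * S (1 / 2)"
proof -
  obtain t where t: "0 < t" "t < 1" "mtrace (C * Z (complex_of_real t)) = complex_of_real f"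
  proof (cases "1 < \<alpha>")
    case True
    then have "0 < b" "b < 1"
      by (auto simp: b field_simps)
    then show ?thesis
      using that trace_b by blast
  next
    case False
    then have "0 < - b" "- b < 1"
      using \<alpha> by (auto simp: b field_simps)
    then show ?thesis
      using that[of "- b"] trace_minus_b assms by simp
  qed
  have "Z 0 = Z 1"
    using tl_eq[OF assms t, of 0] tl_eq[OF assms t, of 1] by simp
  then show ?thesis
    by (simp add: Z_def ms)
qed

end

section \<open>Reduction of a general measurement to a projective one\<close>

lemma mtrace_mult_sum:
  assumes T: "T \<in> carrier_mat n n" and S: "S \<in> carrier_mat n n" and M: "\<And>y. y \<in> I \<Longrightarrow> M y \<in> carrier_mat n n"
    and eq: "\<And>i j. i < n \<Longrightarrow> j < n \<Longrightarrow> S $$ (i, j) = (\<Sum>y\<in>I. a y * M y $$ (i, j))"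
  shows "mtrace (T * S) = (\<Sum>y\<in>I. a y * mtrace (T * M y))"
proof -
  have "mtrace (T * S) = (\<Sum>i<n. \<Sum>j<n. \<Sum>y\<in>I. a y * (T $$ (i, j) * M y $$ (j, i)))"
    using T S by (simp add: mtrace_square[of _ n] eq sum_distrib_left mult_ac)
  also have "\<dots> = (\<Sum>i<n. \<Sum>y\<in>I. \<Sum>j<n. a y * (T $$ (i, j) * M y $$ (j, i)))"
    by (intro sum.cong refl sum.swap)
  also have "\<dots> = (\<Sum>y\<in>I. \<Sum>i<n. \<Sum>j<n. a y * (T $$ (i, j) * M y $$ (j, i)))"
    by (rule sum.swap)
  also have "\<dots> = (\<Sum>y\<in>I. a y * mtrace (T * M y))"
    using T M by (intro sum.cong refl) (simp add: mtrace_square[of _ n] sum_distrib_left)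
  finally show ?thesis .
qed

lemma psd_gram:
  assumes "psd n M"
  obtains G where "G \<in> carrier_mat n n" "M = G\<^sup>\<dagger> * G"
proof -
  obtain U l where U: "unitary n U" and l: "M = spectral_mat n U (\<lambda>i. complex_of_real (l i))" "\<And>i. i < n \<Longrightarrow> 0 \<le> l i"
    using psd_spectral_mat[OF assms] by blast
  define G where "G = spectral_mat n U (\<lambda>i. complex_of_real (sqrt (l i)))"
  have "G\<^sup>\<dagger> * G = spectral_mat n U (\<lambda>i. complex_of_real (sqrt (l i)) * complex_of_real (sqrt (l i)))"
    using U by (simp add: G_def spectral_mat_adjoint spectral_mat_mult)
  also have "\<dots> = M"
    unfolding l(1) using l(2) by (intro spectral_mat_cong) (simp flip: of_real_mult)
  finally show ?thesis
    using that[of G] U by (simp add: G_def)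
qed

lemma hs_smult:
  "hs (c \<cdot>\<^sub>m A) = (cmod c)\<^sup>2 * hs A"
  by (simp add: hs_def norm_mult power_mult_distrib sum_distrib_left)

text \<open>A trace form of the operator Jensen inequality for \<open>t \<mapsto> t\<^sup>b\<close>, where \<open>\<Sum>\<^sub>y w\<^sub>y M\<^sub>y\<close> has the
  eigenvalues \<open>l\<close> in the basis \<open>W\<close>.\<close>
context
  fixes n :: nat and I :: "'y set" and M :: "'y \<Rightarrow> complex mat" and w :: "'y \<Rightarrow> real"
    and W :: "complex mat" and l :: "nat \<Rightarrow> real" and R :: "complex mat" and b F K :: real
  assumes M: "\<And>y. y \<in> I \<Longrightarrow> psd n (M y)" and w: "\<And>y. y \<in> I \<Longrightarrow> 0 < w y"
    and sum1: "\<And>i j. i < n \<Longrightarrow> j < n \<Longrightarrow> (\<Sum>y\<in>I. M y $$ (i, j)) = (if i = j then 1 else 0)"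
    and sumw: "\<And>i j. i < n \<Longrightarrow> j < n \<Longrightarrow> (\<Sum>y\<in>I. complex_of_real (w y) * M y $$ (i, j)) = spectral_mat n W (\<lambda>i. complex_of_real (l i)) $$ (i, j)"
    and W: "unitary n W" and l: "\<And>i. i < n \<Longrightarrow> 0 < l i"
    and R: "R \<in> carrier_mat n n"
    and F: "(\<Sum>y\<in>I. complex_of_real (w y powr b) * mtrace (M y * (R * R\<^sup>\<dagger>))) = complex_of_real F"
    and K: "mtrace (cpow_mat n W l b * (R * R\<^sup>\<dagger>)) = complex_of_real K"
    and pos: "0 < F" "0 < K"
begin

private definition "G y = (SOME G. G \<in> carrier_mat n n \<and> M y = G\<^sup>\<dagger> * G)"
text \<open>The pairing at \<open>t\<close> carries the factors \<open>w^((b+t)/2)\<close> and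
  \<open>l^((b-t)/2)\<close>. At \<open>t = b\<close> only the weights survive and the sum over
  outcomes is \<open>F\<close>; at \<open>t = -b\<close> only \<open>l^b\<close> survives and, the
  \<open>M y\<close> summing to the identity, the result is \<open>K\<close>.\<close>

private definition "Cy y = complex_of_real (w y powr (b / 2)) \<cdot>\<^sub>m (G y * R)\<^sup>\<dagger>"
private definition Zy :: "'y \<Rightarrow> complex \<Rightarrow> complex mat" where
  "Zy y z = exp (complex_of_real (ln (w y) / 2) * z) \<cdot>\<^sub>m (G y * (cpow_mat n W l ((complex_of_real b - z) / 2) * R))"

private lemma G: "G y \<in> carrier_mat n n" "M y = (G y)\<^sup>\<dagger> * G y" if "y \<in> I"
proof -
  have "\<exists>G. G \<in> carrier_mat n n \<and> M y = G\<^sup>\<dagger> * G"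
    using psd_gram[OF M[OF that]] by metis
  then have "G y \<in> carrier_mat n n \<and> M y = (G y)\<^sup>\<dagger> * G y"
    unfolding G_def by (rule someI_ex)
  then show "G y \<in> carrier_mat n n" "M y = (G y)\<^sup>\<dagger> * G y"
    by blast+
qed

private lemma Mc: "M y \<in> carrier_mat n n" if "y \<in> I"
  using M[OF that] by (simp add: psd_def)

private lemma Cy: "Cy y \<in> carrier_mat n n" if "y \<in> I"
  using G[OF that] R by (simp add: Cy_def)

private lemma Zy: "strip_mat n (Zy y)" if "y \<in> I"
proof -
  define H where "H z = G y * (cpow_mat n W l ((complex_of_real b - z) / 2) * R)" for z
  have H: "strip_mat n H"
    unfolding H_def using G[OF that] R
    by (intro strip_mat_mult strip_mat_const strip_mat_cpow[OF W, of _ "b/2" "-1/2"]) (auto simp: field_simps)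
  have e: "strip_fun (\<lambda>z. exp (complex_of_real (ln (w y) / 2) * z))"
    using strip_fun_exp[of 0 1 "ln (w y) / 2"] by (simp add: mult.commute)
  have Hc: "H z \<in> carrier_mat n n" for z
    using H by (simp add: strip_mat_def)
  have "strip_fun (\<lambda>z. (exp (complex_of_real (ln (w y) / 2) * z) \<cdot>\<^sub>m H z) $$ (i, j))" if "i < n" "j < n" for i j
  proof -
    have "(exp (complex_of_real (ln (w y) / 2) * z) \<cdot>\<^sub>m H z) $$ (i, j) = exp (complex_of_real (ln (w y) / 2) * z) * H z $$ (i, j)" for z
      using Hc[of z] that by simp
    then show ?thesis
      using H that by (simp only:) (intro strip_fun_mult e, simp add: strip_mat_def)
  qed
  then show ?thesis
    using Hc by (simp add: strip_mat_def Zy_def H_def)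
qed

private lemma hs_Cy: "(\<Sum>y\<in>I. hs (Cy y)) = F"
proof -
  have "complex_of_real (hs (Cy y)) = complex_of_real (w y powr b) * mtrace (M y * (R * R\<^sup>\<dagger>))" if y: "y \<in> I" for y
  proof -
    have "complex_of_real (hs ((G y * R)\<^sup>\<dagger>)) = mtrace (R\<^sup>\<dagger> * (M y * R))"
      unfolding hs_adjoint using G[OF y] R by (simp add: hs_eq_mtrace adjoint_mult_square[of _ n] assoc_square[of _ n])
    also have "\<dots> = mtrace (M y * (R * R\<^sup>\<dagger>))"
      using Mc[OF y] R mtrace_comm_square[of "R\<^sup>\<dagger>" n "M y * R"] by (simp add: assoc_square[of _ n])
    finally show ?thesis
      using w[OF y] by (simp add: Cy_def hs_smult powr_power)
  qed
  then have "complex_of_real (\<Sum>y\<in>I. hs (Cy y)) = complex_of_real F"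
    unfolding of_real_sum F[symmetric] by (intro sum.cong refl)
  then show ?thesis
    by (simp only: of_real_eq_iff)
qed

text \<open>\<open>S\<close> stands for the sum of the \<open>M y\<close> weighted by
  \<open>w^(Re z)\<close>: it will be the identity for \<open>Re z = 0\<close> and the matrix with
  eigenvalues \<open>l\<close> for \<open>Re z = 1\<close>. In both cases it merges with the powers
  of \<open>l\<close> around it to \<open>l^b\<close>, as \<open>mid\<close> demands, so both edges
  give the same constant.\<close>

private lemma hs_Zy:
  assumes S: "S \<in> carrier_mat n n" "\<And>i j. i < n \<Longrightarrow> j < n \<Longrightarrow> S $$ (i, j) = (\<Sum>y\<in>I. complex_of_real (w y powr Re z) * M y $$ (i, j))"
    and mid: "cpow_mat n W l ((complex_of_real b - cnj z) / 2) * (S * cpow_mat n W l ((complex_of_real b - z) / 2)) = cpow_mat n W l b"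
  shows "(\<Sum>y\<in>I. hs (Zy y z)) = K"
proof -
  define Y where "Y = cpow_mat n W l ((complex_of_real b - z) / 2) * R"
  have Y: "Y \<in> carrier_mat n n"
    using W R by (simp add: Y_def)
  have "complex_of_real (\<Sum>y\<in>I. hs (Zy y z)) = (\<Sum>y\<in>I. complex_of_real (w y powr Re z) * mtrace ((Y * Y\<^sup>\<dagger>) * M y))"
    unfolding of_real_sum
  proof (intro sum.cong refl)
    fix y assume y: "y \<in> I"
    have "complex_of_real (hs (G y * Y)) = mtrace (Y\<^sup>\<dagger> * (M y * Y))"
      using G[OF y] Y by (simp add: hs_eq_mtrace adjoint_mult_square[of _ n] assoc_square[of _ n])
    also have "\<dots> = mtrace (Y\<^sup>\<dagger> * M y * Y)"
      using Mc[OF y] Y by (simp add: assoc_square[of _ n])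
    also have "\<dots> = mtrace ((Y * Y\<^sup>\<dagger>) * M y)"
      using Mc[OF y] Y mtrace_comm_square[of "Y\<^sup>\<dagger> * M y" n Y] by (simp add: assoc_square[of _ n])
    finally have *: "complex_of_real (hs (G y * Y)) = mtrace ((Y * Y\<^sup>\<dagger>) * M y)" .
    have "(cmod (exp (complex_of_real (ln (w y) / 2) * z)))\<^sup>2 = w y powr Re z"
      using w[OF y] by (simp add: norm_exp_eq_Re powr_def power2_eq_square exp_add[symmetric] field_simps)
    then have "hs (Zy y z) = w y powr Re z * hs (G y * Y)"
      by (simp add: Zy_def hs_smult Y_def)
    then show "complex_of_real (hs (Zy y z)) = complex_of_real (w y powr Re z) * mtrace ((Y * Y\<^sup>\<dagger>) * M y)"
      by (simp add: *)
  qed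
  also have "\<dots> = mtrace ((Y * Y\<^sup>\<dagger>) * S)"
    using Y S Mc by (intro mtrace_mult_sum[symmetric]) auto
  also have "\<dots> = mtrace (cpow_mat n W l ((complex_of_real b - z) / 2) * (R * (R\<^sup>\<dagger> * (cpow_mat n W l ((complex_of_real b - cnj z) / 2) * S))))"
    using W R S(1) by (simp add: Y_def adjoint_mult_square[of _ n] assoc_square[of _ n] cpow_mat_adjoint)
  also have "\<dots> = mtrace ((R * R\<^sup>\<dagger>) * (cpow_mat n W l ((complex_of_real b - cnj z) / 2) * (S * cpow_mat n W l ((complex_of_real b - z) / 2))))"
    using W R S(1) mtrace_comm_square[of "cpow_mat n W l ((complex_of_real b - z) / 2)" n
      "R * (R\<^sup>\<dagger> * (cpow_mat n W l ((complex_of_real b - cnj z) / 2) * S))"]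
    by (simp add: assoc_square[of _ n])
  also have "\<dots> = complex_of_real K"
    unfolding mid K[symmetric] using W R by (intro mtrace_comm_square) auto
  finally show ?thesis
    by (simp only: of_real_eq_iff)
qed

private lemma hs_Zy0: "(\<Sum>y\<in>I. hs (Zy y z)) = K" if z: "Re z = 0"
proof (rule hs_Zy[of "1\<^sub>m n"])
  show "1\<^sub>m n $$ (i, j) = (\<Sum>y\<in>I. complex_of_real (w y powr Re z) * M y $$ (i, j))" if "i < n" "j < n" for i j
  proof -
    have "(\<Sum>y\<in>I. complex_of_real (w y powr Re z) * M y $$ (i, j)) = (\<Sum>y\<in>I. M y $$ (i, j))"
      using w z by (intro sum.cong) force+
    then show ?thesis
      using sum1[OF that] that by simp
  qed
  have "(complex_of_real b - cnj z) / 2 + (complex_of_real b - z) / 2 = complex_of_real b"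
    using z by (simp add: complex_eq_iff)
  then show "cpow_mat n W l ((complex_of_real b - cnj z) / 2) * (1\<^sub>m n * cpow_mat n W l ((complex_of_real b - z) / 2)) = cpow_mat n W l b"
    using W by (simp add: one_square cpow_mat_mult)
qed simp

private lemma hs_Zy1: "(\<Sum>y\<in>I. hs (Zy y z)) = K" if z: "Re z = 1"
proof (rule hs_Zy[of "cpow_mat n W l 1"])
  show "cpow_mat n W l 1 $$ (i, j) = (\<Sum>y\<in>I. complex_of_real (w y powr Re z) * M y $$ (i, j))" if "i < n" "j < n" for i j
  proof -
    have "(\<Sum>y\<in>I. complex_of_real (w y powr Re z) * M y $$ (i, j)) = (\<Sum>y\<in>I. complex_of_real (w y) * M y $$ (i, j))"
      using w z by (intro sum.cong) force+
    then show ?thesis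
      using sumw[OF that] cpow_mat_1[OF l] by simp
  qed
  have "(complex_of_real b - cnj z) / 2 + (1 + (complex_of_real b - z) / 2) = complex_of_real b"
    using z by (simp add: complex_eq_iff)
  then show "cpow_mat n W l ((complex_of_real b - cnj z) / 2) * (cpow_mat n W l 1 * cpow_mat n W l ((complex_of_real b - z) / 2)) = cpow_mat n W l b"
    using W by (simp add: cpow_mat_mult)
qed (use W in simp)

private lemma trace_CZ:
  assumes "y \<in> I"
  shows "mtrace (Cy y * Zy y (complex_of_real t)) = complex_of_real (w y powr ((b + t) / 2)) *
    mtrace (R\<^sup>\<dagger> * (M y * (cpow_mat n W l ((b - t) / 2) * R)))"
proof -
  let ?Y = "cpow_mat n W l ((b - t) / 2) * R"
  have Y: "?Y \<in> carrier_mat n n"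
    using W R by simp
  have "Cy y * Zy y (complex_of_real t) = complex_of_real (w y powr ((b + t) / 2)) \<cdot>\<^sub>m ((G y * R)\<^sup>\<dagger> * (G y * ?Y))"
  proof -
    have "complex_of_real (w y powr (b / 2)) * exp (complex_of_real (ln (w y) / 2) * complex_of_real t) = complex_of_real (w y powr ((b + t) / 2))"
      using w[OF assms] by (simp add: powr_def exp_of_real[symmetric] exp_add[symmetric] field_simps)
    then show ?thesis
      using G(1)[OF assms] R Y unfolding Cy_def Zy_def
      by (subst mult_smult_distrib[of _ n n _ n], simp, simp, subst mult_smult_assoc_mat[of _ n n _ n])
        (auto intro!: eq_matI simp: mult.commute)
  qed
  moreover have "(G y * R)\<^sup>\<dagger> * (G y * ?Y) = R\<^sup>\<dagger> * (M y * ?Y)"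
    using G[OF assms] R Y by (simp add: adjoint_mult_square[of _ n] assoc_square[of _ n])
  moreover have "mtrace (c \<cdot>\<^sub>m A) = c * mtrace A" if "A \<in> carrier_mat n n" for c A
    using that by (simp add: mtrace_def sum_distrib_left)
  ultimately show ?thesis
    using Mc[OF assms] R Y by simp
qed

private lemma tl_povm:
  assumes "0 \<le> t" "t \<le> 1"
  shows "(cmod (\<Sum>y\<in>I. mtrace (Cy y * Zy y (complex_of_real t))))\<^sup>2 \<le> F * K"
proof -
  have "K powr (1 - t) * K powr t = K"
    using pos by (simp flip: powr_add)
  then show ?thesis
    using matrix_three_lines_le[of I Cy n Zy F K K t] Cy Zy hs_Cy hs_Zy0 hs_Zy1 pos assms
    by simp
qed

text \<open>The interior point is \<open>b\<close>, where the pairing is \<open>F\<close>; the bound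
  becomes \<open>F * F \<le> F * K\<close>.\<close>

lemma povm_jensen_pos:
  assumes "0 < b" "b < 1"
  shows "F \<le> K"
proof -
  have "(\<Sum>y\<in>I. mtrace (Cy y * Zy y (complex_of_real b))) = complex_of_real F"
    unfolding F[symmetric]
  proof (intro sum.cong refl)
    fix y assume y: "y \<in> I"
    have "mtrace (Cy y * Zy y (complex_of_real b)) = complex_of_real (w y powr b) * mtrace (R\<^sup>\<dagger> * (M y * R))"
      using W R by (simp add: trace_CZ[OF y] cpow_mat_0 one_square)
    then show "mtrace (Cy y * Zy y (complex_of_real b)) = complex_of_real (w y powr b) * mtrace (M y * (R * R\<^sup>\<dagger>))"
      using Mc[OF y] R mtrace_comm_square[of "R\<^sup>\<dagger>" n "M y * R"] by (simp add: assoc_square[of _ n])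
  qed
  then have "F * F \<le> F * K"
    using tl_povm[of b] assms pos by (simp add: power2_eq_square)
  then show ?thesis
    using pos by simp
qed

text \<open>The interior point is \<open>-b\<close>, where the pairing is \<open>K\<close>, so the
  bound \<open>K * K \<le> F * K\<close> points the other way.\<close>

lemma povm_jensen_neg:
  assumes "b < 0" "- 1 < b"
  shows "K \<le> F"
proof -
  let ?P = "cpow_mat n W l b * (R * R\<^sup>\<dagger>)"
  have P: "?P \<in> carrier_mat n n"
    using W R by simp
  have "(\<Sum>y\<in>I. mtrace (Cy y * Zy y (complex_of_real (- b)))) = (\<Sum>y\<in>I. 1 * mtrace (?P * M y))"
  proof (intro sum.cong refl)
    fix y assume y: "y \<in> I"
    have "mtrace (Cy y * Zy y (complex_of_real (- b))) = mtrace (R\<^sup>\<dagger> * (M y * (cpow_mat n W l b * R)))"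
      using w[OF y] trace_CZ[OF y, of "- b"] by (simp add: field_simps)
    also have "\<dots> = mtrace ((R\<^sup>\<dagger> * M y) * (cpow_mat n W l b * R))"
      using W R Mc[OF y] by (simp add: assoc_square[of _ n])
    also have "\<dots> = mtrace (?P * M y)"
      using W R Mc[OF y] by (subst mtrace_comm_square[of _ n]) (simp_all add: assoc_square[of _ n])
    finally show "mtrace (Cy y * Zy y (complex_of_real (- b))) = 1 * mtrace (?P * M y)"
      by simp
  qed
  also have "\<dots> = mtrace (?P * 1\<^sub>m n)"
    using P Mc by (intro mtrace_mult_sum[symmetric]) (auto simp: sum1)
  also have "\<dots> = complex_of_real K"
    using P K by (simp add: one_square)
  finally have "K * K \<le> F * K"
    using tl_povm[of "- b"] assms pos by (simp add: power2_eq_square)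
  then show ?thesis
    using pos by simp
qed

end

section \<open>Measured versus sandwiched Renyi divergence\<close>

text \<open>As \<open>p \<noteq> 0\<close>, an eigenvalue of the real power determines
  \<open>ln (l i)\<close> and with it every complex power, so the intertwining lemma applies with
  equal decompositions.\<close>

lemma cpow_mat_commute:
  assumes U: "unitary n U" and l: "\<And>i. i < n \<Longrightarrow> 0 < l i" and T: "T \<in> carrier_mat n n" and p: "p \<noteq> 0"
    and eq: "cpow_mat n U l (complex_of_real p) * T = T * cpow_mat n U l (complex_of_real p)"
  shows "cpow_mat n U l z * T = T * cpow_mat n U l z"
  unfolding cpow_mat_def
proof (rule spectral_mat_intertwine[OF U U T eq[unfolded cpow_mat_def]])
  fix i j assume ij: "i < n" "j < n"
    and e: "exp (complex_of_real p * complex_of_real (ln (l i))) = exp (complex_of_real p * complex_of_real (ln (l j)))"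
  have "exp (p * ln (l i)) = exp (p * ln (l j))"
    using e unfolding of_real_mult[symmetric] exp_of_real of_real_eq_iff .
  then have "ln (l i) = ln (l j)"
    using p by simp
  then show "exp (z * complex_of_real (ln (l i))) = exp (z * complex_of_real (ln (l j)))"
    by simp
qed

text \<open>The left side is the tangent, along the diagonal, of the convex homogeneous function on
  the right. It follows from Young's inequality for \<open>A\<close> and \<open>c\<close>, because
  \<open>a\<close> is the weighted geometric mean
  \<open>A^(1/\<alpha>) * c^(1-1/\<alpha>)\<close>.\<close>

lemma powr_tangent_gt_1:
  fixes a c \<alpha> :: real
  assumes "1 < \<alpha>" "0 < a" "0 < c"
  shows "\<alpha> * a + (1 - \<alpha>) * c \<le> a powr \<alpha> * c powr (1 - \<alpha>)"
proof -
  define A where "A = a powr \<alpha> * c powr (1 - \<alpha>)"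
  have "A powr (1 / \<alpha>) * c powr (1 - 1 / \<alpha>) = a * (c powr ((1 - \<alpha>) / \<alpha>) * c powr (1 - 1 / \<alpha>))"
    using assms by (simp add: A_def powr_mult powr_powr)
  also have "c powr ((1 - \<alpha>) / \<alpha>) * c powr (1 - 1 / \<alpha>) = 1"
    using assms by (simp add: diff_divide_distrib flip: powr_add)
  finally have "a \<le> 1 / \<alpha> * A + (1 - 1 / \<alpha>) * c"
    using Youngs_inequality_0[of "1 / \<alpha>" "1 - 1 / \<alpha>" A c] assms by (simp add: A_def)
  then have "\<alpha> * a \<le> \<alpha> * (1 / \<alpha> * A + (1 - 1 / \<alpha>) * c)"
    using assms by (intro mult_left_mono) auto
  also have "\<dots> = A + (\<alpha> - 1) * c"
    using assms by (simp add: field_simps)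
  finally show ?thesis
    by (simp add: A_def algebra_simps)
qed

lemma powr_tangent_lt_1:
  fixes a c \<alpha> :: real
  assumes "0 < \<alpha>" "\<alpha> < 1" "0 < a" "0 < c"
  shows "a powr \<alpha> * c powr (1 - \<alpha>) \<le> \<alpha> * a + (1 - \<alpha>) * c"
  using Youngs_inequality_0[of \<alpha> "1 - \<alpha>" a c] assms by simp

text \<open>The reason for the weight \<open>w = (P / q)^\<alpha>\<close>: both
  \<open>w^b * P\<close> and \<open>w * q\<close> become the Renyi summand, so the traces against
  \<rho> and \<sigma> have a common value.\<close>

lemma powr_ratio_weight:
  fixes P q \<alpha> :: real
  assumes "0 < P" "0 < q" "\<alpha> \<noteq> 0"
  shows "((P / q) powr \<alpha>) powr ((\<alpha> - 1) / \<alpha>) * P = P powr \<alpha> * q powr (1 - \<alpha>)"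
    and "(P / q) powr \<alpha> * q = P powr \<alpha> * q powr (1 - \<alpha>)"
proof -
  have "((P / q) powr \<alpha>) powr ((\<alpha> - 1) / \<alpha>) = (P / q) powr (\<alpha> - 1)"
    using assms by (simp add: powr_powr)
  also have "\<dots> = P powr (\<alpha> - 1) / q powr (\<alpha> - 1)"
    using assms by (simp add: powr_divide)
  also have "\<dots> = P powr (\<alpha> - 1) * q powr (1 - \<alpha>)"
    using powr_minus_divide[of q "\<alpha> - 1"] by simp
  finally show "((P / q) powr \<alpha>) powr ((\<alpha> - 1) / \<alpha>) * P = P powr \<alpha> * q powr (1 - \<alpha>)"
    using assms by (simp add: powr_diff)
  show "(P / q) powr \<alpha> * q = P powr \<alpha> * q powr (1 - \<alpha>)"
    using assms by (simp add: powr_divide powr_diff)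
qed

text \<open>Since \<open>b * \<alpha> = \<alpha> - 1\<close> for the exponent \<open>b\<close> of
  \<open>l\<close>, the powers of \<open>l\<close> cancel. Summands can thus be rescaled by
  eigenvalues before a tangent inequality is applied to them.\<close>

lemma powr_weight_cancel:
  fixes P q l \<alpha> :: real
  assumes "0 < P" "0 < q" "0 < l" "\<alpha> \<noteq> 0"
  shows "(l powr ((\<alpha> - 1) / \<alpha>) * P) powr \<alpha> * (l * q) powr (1 - \<alpha>) = P powr \<alpha> * q powr (1 - \<alpha>)"
proof -
  have "l powr (\<alpha> - 1) * l powr (1 - \<alpha>) = 1"
    using assms by (simp flip: powr_add)
  then show ?thesis
    using assms by (simp add: powr_mult powr_powr mult_ac)
qed

text \<open>The Renyi sum of the projective measurement onto the columns of a unitary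
  \<open>W\<close>.\<close>

definition basis_sum :: "real \<Rightarrow> nat \<Rightarrow> complex mat \<Rightarrow> complex mat \<Rightarrow> complex mat \<Rightarrow> real" where
  "basis_sum \<alpha> n \<rho> \<sigma> W = (\<Sum>i<n. diag_in W \<rho> i powr \<alpha> * diag_in W \<sigma> i powr (1 - \<alpha>))"

context
  fixes n :: nat and \<rho> \<sigma> :: "complex mat" and \<alpha> :: real
  assumes \<rho>: "pd n \<rho>" and \<sigma>: "pd n \<sigma>" and n: "0 < n" and \<alpha>: "1/2 < \<alpha>" "\<alpha> \<noteq> 1"
begin

lemma basis_sum_pos:
  assumes "unitary n W"
  shows "0 < basis_sum \<alpha> n \<rho> \<sigma> W"
  unfolding basis_sum_def using diag_in_pd(2)[OF assms \<rho>] diag_in_pd(2)[OF assms \<sigma>] n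
  by (intro sum_pos) (auto simp: order_less_imp_not_eq2)

private lemma carriers: "\<rho> \<in> carrier_mat n n" "\<sigma> \<in> carrier_mat n n"
  using \<rho> \<sigma> by (simp_all add: pd_def)

private lemma mtrace_cpow:
  assumes W: "unitary n W" and w: "\<And>i. i < n \<Longrightarrow> 0 < w i" and A: "pd n A"
  shows "mtrace (cpow_mat n W w (complex_of_real p) * A) = complex_of_real (\<Sum>i<n. w i powr p * diag_in W A i)"
proof -
  have "A \<in> carrier_mat n n"
    using A by (simp add: pd_def)
  then show ?thesis
    using mtrace_spectral_mat_mult[OF W] diag_in_pd(1)[OF W A] by (simp add: cpow_mat_of_real[OF w])
qed

lemma basis_sum_sandwiched:
  assumes W: "unitary n W"
  shows "1 / (\<alpha> - 1) * ln (basis_sum \<alpha> n \<rho> \<sigma> W) \<le> sandwiched_renyi \<alpha> \<rho> \<sigma>"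
    and "1 / (\<alpha> - 1) * ln (basis_sum \<alpha> n \<rho> \<sigma> W) = sandwiched_renyi \<alpha> \<rho> \<sigma> \<Longrightarrow> \<rho> * \<sigma> = \<sigma> * \<rho>"
proof -
  define b where "b = (\<alpha> - 1) / \<alpha>"
  obtain U s where U: "unitary n U" and s: "\<sigma> = spectral_mat n U (\<lambda>i. complex_of_real (s i))" "\<And>i. i < n \<Longrightarrow> 0 < s i"
    using pd_spectral_mat[OF \<sigma>] by blast
  obtain U' r where U': "unitary n U'" and r: "\<rho> = spectral_mat n U' (\<lambda>i. complex_of_real (r i))" "\<And>i. i < n \<Longrightarrow> 0 < r i"
    using pd_spectral_mat[OF \<rho>] by blast
  let ?S = "cpow_mat n U s" and ?R = "cpow_mat n U' r"
  have S1: "\<sigma> = ?S 1"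
    unfolding s(1) by (rule cpow_mat_1[symmetric]) (fact s(2))
  have R1: "\<rho> = ?R 1"
    unfolding r(1) by (rule cpow_mat_1[symmetric]) (fact r(2))
  note ms = cpow_mat_mult[OF U] cpow_mat_mult[OF U'] cpow_mat_adjoint[OF U] cpow_mat_adjoint[OF U']
    cpow_mat_0[OF U] cpow_mat_0[OF U'] U U' assoc_square[of _ n] adjoint_mult_square[of _ n] one_square[of _ n]
  \<comment> \<open>The Gram matrix of \<open>\<rho>^(1/2) \<sigma>^(-b/2)\<close> is the sandwiched
    matrix, and invertibility of \<open>G\<close> makes its eigenvalues strictly positive.\<close>
  define G where "G = ?R (1/2) * ?S (- b / 2)"
  have "G \<in> carrier_mat n n" "?S (b / 2) * ?R (- 1/2) \<in> carrier_mat n n" "(?S (b / 2) * ?R (- 1/2)) * G = 1\<^sub>m n"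
    by (simp_all add: G_def ms)
  then obtain V x where V: "unitary n V" and x: "G\<^sup>\<dagger> * G = spectral_mat n V (\<lambda>i. complex_of_real (x i))" "\<And>i. i < n \<Longrightarrow> 0 < x i"
    using gram_spectral_mat by blast
  let ?X = "cpow_mat n V x"
  have GG: "G\<^sup>\<dagger> * G = ?S (- b / 2) * (\<rho> * ?S (- b / 2))"
    by (simp add: G_def ms R1)
  have X1: "?X 1 = ?S (- b / 2) * (\<rho> * ?S (- b / 2))"
    unfolding GG[symmetric] x(1) by (rule cpow_mat_1) (fact x(2))
  have \<rho>X: "\<rho> = ?S (b / 2) * (?X 1 * ?S (b / 2))"
    unfolding X1 using carriers(1) by (simp add: ms)
  define Q where "Q = (\<Sum>i<n. x i powr \<alpha>)"
  have Q: "mtrace (?X \<alpha>) = complex_of_real Q"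
    using x(2) by (simp add: cpow_mat_of_real mtrace_spectral_mat[OF V] Q_def)
  have Qpos: "0 < Q"
    unfolding Q_def using x(2) n by (intro sum_pos) (auto simp: order_less_imp_not_eq2)
  have sand: "sandwiched_renyi \<alpha> \<rho> \<sigma> = 1 / (\<alpha> - 1) * ln Q"
  proof -
    have "complex_of_real ((1 - \<alpha>) / (2 * \<alpha>)) = - b / 2"
      using \<alpha> by (simp add: b_def field_simps)
    then have "mpow \<sigma> ((1 - \<alpha>) / (2 * \<alpha>)) = ?S (- b / 2)"
      unfolding s(1) using mpow_eq_cpow_mat[of n U s, OF U s(2)] by presburger
    then have "mpow \<sigma> ((1 - \<alpha>) / (2 * \<alpha>)) * \<rho> * mpow \<sigma> ((1 - \<alpha>) / (2 * \<alpha>)) = spectral_mat n V (\<lambda>i. complex_of_real (x i))"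
      using x(1) GG carriers(1) by (simp add: ms)
    then show ?thesis
      unfolding sandwiched_renyi_def using mpow_eq_cpow_mat[of n V x \<alpha>, OF V x(2)] Q by simp
  qed
  define P where "P i = diag_in W \<rho> i" for i
  define q where "q i = diag_in W \<sigma> i" for i
  have P: "0 < P i" and q: "0 < q i" if "i < n" for i
    using diag_in_pd(2)[OF W \<rho> that] diag_in_pd(2)[OF W \<sigma> that] by (simp_all add: P_def q_def)
  define w where "w i = (P i / q i) powr \<alpha>" for i
  have w: "0 < w i" if "i < n" for i
    using P[OF that] q[OF that] by (simp add: w_def)
  let ?W = "cpow_mat n W w"
  define f where "f = basis_sum \<alpha> n \<rho> \<sigma> W"
  have f: "0 < f"
    using basis_sum_pos[OF W] by (simp add: f_def)
  have wP: "w i powr b * P i = P i powr \<alpha> * q i powr (1 - \<alpha>)" if "i < n" for i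
    using powr_ratio_weight(1)[OF P[OF that] q[OF that]] \<alpha> by (simp add: w_def b_def)
  have wq: "w i powr 1 * q i = P i powr \<alpha> * q i powr (1 - \<alpha>)" if "i < n" for i
    using powr_ratio_weight(2)[OF P[OF that] q[OF that]] \<alpha> by (simp add: w_def)
  have f_P: "(\<Sum>i<n. w i powr b * P i) = f" and f_q: "(\<Sum>i<n. w i powr 1 * q i) = f"
    unfolding f_def basis_sum_def P_def[symmetric] q_def[symmetric]
    by (intro sum.cong; simp only: wP wq lessThan_iff)+
  have "mtrace (?W b * \<rho>) = complex_of_real f"
    unfolding f_P[symmetric] P_def by (rule mtrace_cpow) (use W w \<rho> in auto)
  moreover have "mtrace (?S (b / 2) * (?X 1 * (?S (b / 2) * ?W b))) = mtrace (\<rho> * ?W b)"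
    by (subst \<rho>X) (use W V in \<open>simp add: ms\<close>)
  ultimately have f1: "mtrace (?S (b / 2) * (?X 1 * (?S (b / 2) * ?W b))) = complex_of_real f"
    using W mtrace_comm_square[of "?W b" n \<rho>] carriers(1) by simp
  have "mtrace (?W (complex_of_real 1) * \<sigma>) = complex_of_real f"
    unfolding f_q[symmetric] q_def by (rule mtrace_cpow) (use W w \<sigma> in auto)
  then have f2: "mtrace (?S 1 * ?W 1) = complex_of_real f"
    unfolding S1[symmetric] using W mtrace_comm_square[of "?W 1" n \<sigma>] carriers(2) by simp
  note args = U V W \<alpha> b_def f1 f2 Q f Qpos
  show le: "1 / (\<alpha> - 1) * ln (basis_sum \<alpha> n \<rho> \<sigma> W) \<le> sandwiched_renyi \<alpha> \<rho> \<sigma>"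
  proof (cases "1 < \<alpha>")
    case True
    then show ?thesis
      using sandwich_gt_1[OF args] f Qpos unfolding sand f_def[symmetric] by (simp add: divide_right_mono)
  next
    case False
    then show ?thesis
      using sandwich_lt_1[OF args] f Qpos \<alpha> unfolding sand f_def[symmetric] by (simp add: divide_right_mono_neg)
  qed
  show "\<rho> * \<sigma> = \<sigma> * \<rho>" if "1 / (\<alpha> - 1) * ln (basis_sum \<alpha> n \<rho> \<sigma> W) = sandwiched_renyi \<alpha> \<rho> \<sigma>"
  proof -
    have "f = Q"
      using that f Qpos \<alpha> unfolding sand f_def[symmetric] by simp
    then have X: "?X (\<alpha> / 2) = ?W (1 / 2) * ?S (1 / 2)"
      using sandwich_eq[OF args] by simp
    have "(?X (\<alpha> / 2))\<^sup>\<dagger> = ?S (1 / 2) * ?W (1 / 2)"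
      unfolding X using W by (simp add: ms cpow_mat_adjoint[OF W])
    then have X': "?X (\<alpha> / 2) = ?S (1 / 2) * ?W (1 / 2)"
      by (simp add: cpow_mat_adjoint[OF V])
    \<comment> \<open>By the two expressions for \<open>?X (\<alpha> / 2)\<close> the square roots
      of \<omega> and \<sigma> commute, hence that of \<sigma> commutes with
      \<open>?X (\<alpha> / 2)\<close>. Changing the exponent first in \<sigma> and then in
      \<open>X\<close> shows that \<sigma> commutes with \<open>X\<close>, and so with
      \<rho>.\<close>
    have SX: "?S (complex_of_real (1 / 2)) * ?X (\<alpha> / 2) = ?X (\<alpha> / 2) * ?S (complex_of_real (1 / 2))"
    proof -
      have "?S (1 / 2) * ?X (\<alpha> / 2) = ?S (1 / 2) * ?W (1 / 2) * ?S (1 / 2)"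
        unfolding X using W by (simp add: assoc_square[of _ n] U)
      then show ?thesis
        unfolding X'[symmetric] by simp
    qed
    have S1X: "?S 1 * ?X (\<alpha> / 2) = ?X (\<alpha> / 2) * ?S 1"
      by (rule cpow_mat_commute[of n U s "?X (\<alpha> / 2)" "1 / 2"]) (use SX U V s(2) in simp_all)
    have X1S: "?X 1 * ?S 1 = ?S 1 * ?X 1"
      by (rule cpow_mat_commute[of n V x "?S 1" "\<alpha> / 2"]) (use S1X U V x(2) \<alpha> in auto)
    have "\<rho> * \<sigma> = ?S (b / 2) * ((?X 1 * ?S 1) * ?S (b / 2))"
      unfolding \<rho>X S1 using V by (simp add: ms add.commute)
    also have "\<dots> = \<sigma> * \<rho>"
      unfolding \<rho>X S1 X1S using V by (simp add: ms add.commute)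
    finally show ?thesis .
  qed
qed

text \<open>\<open>W\<close> diagonalises the weighted sum \<open>\<Omega>\<close> of the effects,
  with eigenvalues \<open>l\<close>. By linearity the sum of \<open>l * q'\<close> is
  \<open>F\<close>, and the Jensen inequality compares \<open>K\<close>, the sum of
  \<open>l^b * P'\<close>, with \<open>F\<close>. The tangent inequality then compares the basis sum
  with \<open>\<alpha> * K + (1 - \<alpha>) * F\<close>.\<close>

lemma renyi_sum_le_basis_sum:
  assumes "povm n X M"
  obtains W where "unitary n W"
    "1 / (\<alpha> - 1) * ln (renyi_sum \<alpha> \<rho> \<sigma> X M) \<le> 1 / (\<alpha> - 1) * ln (basis_sum \<alpha> n \<rho> \<sigma> W)"
proof -
  have fin: "finite X" and MX: "\<And>y. y \<in> X \<Longrightarrow> psd n (M y)"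
    and MX1: "\<And>i j. i < n \<Longrightarrow> j < n \<Longrightarrow> (\<Sum>y\<in>X. M y $$ (i, j)) = (if i = j then 1 else 0)"
    using assms by (auto simp: povm_def)
  define b where "b = (\<alpha> - 1) / \<alpha>"
  \<comment> \<open>Zero effects are discarded so that the remaining weights under \<rho> and
    \<sigma> are strictly positive and can be divided.\<close>
  define I where "I = {y \<in> X. M y \<noteq> 0\<^sub>m n n}"
  have I: "finite I" "I \<subseteq> X"
    using fin by (auto simp: I_def)
  have M: "psd n (M y)" if "y \<in> I" for y
    using that I MX by auto
  have Mc: "M y \<in> carrier_mat n n" if "y \<in> I" for y
    using M[OF that] by (simp add: psd_def)
  have sum1: "(\<Sum>y\<in>I. M y $$ (i, j)) = (if i = j then 1 else 0)" if "i < n" "j < n" for i j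
    unfolding MX1[OF that, symmetric] using fin that by (intro sum.mono_neutral_left) (auto simp: I_def)
  define p where "p y = prob_meas \<rho> M y" for y
  define q where "q y = prob_meas \<sigma> M y" for y
  have tr_p: "mtrace (M y * \<rho>) = complex_of_real (p y)" and tr_q: "mtrace (M y * \<sigma>) = complex_of_real (q y)"
    and p: "0 < p y" and q: "0 < q y" if "y \<in> I" for y
    using mtrace_psd_pd[OF M[OF that] \<rho>] mtrace_psd_pd[OF M[OF that] \<sigma>] that
    by (auto simp: p_def q_def prob_meas_def I_def less_le)
  define F where "F = (\<Sum>y\<in>I. p y powr \<alpha> * q y powr (1 - \<alpha>))"
  have renyi: "renyi_sum \<alpha> \<rho> \<sigma> X M = F"
  proof -
    have "p y = 0" if "y \<in> X - I" for y
      using that carriers(1) by (simp add: p_def prob_meas_def I_def mtrace_def)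
    then have "renyi_sum \<alpha> \<rho> \<sigma> X M = (\<Sum>y\<in>I. if p y = 0 then 0 else p y powr \<alpha> * q y powr (1 - \<alpha>))"
      unfolding renyi_sum_def p_def[symmetric] q_def[symmetric]
      using fin I by (intro sum.mono_neutral_right) auto
    also have "\<dots> = F"
      unfolding F_def using p by (intro sum.cong) (auto simp: order_less_imp_not_eq2)
    finally show ?thesis .
  qed
  \<comment> \<open>An empty sum cannot produce the diagonal entry 1 of the identity, which exists
    because \<open>n > 0\<close>.\<close>
  have "I \<noteq> {}"
    using sum1[OF n n] by auto
  then have F: "0 < F"
    unfolding F_def using I(1) p q by (intro sum_pos) (auto simp: order_less_imp_not_eq2)
  define w where "w y = (p y / q y) powr \<alpha>" for y
  have w: "0 < w y" if "y \<in> I" for y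
    using p[OF that] q[OF that] by (simp add: w_def)
  define \<Omega> where "\<Omega> = mat n n (\<lambda>(i, j). \<Sum>y\<in>I. complex_of_real (w y) * M y $$ (i, j))"
  have \<Omega>: "\<Omega> \<in> carrier_mat n n" and \<Omega>_index: "\<And>i j. i < n \<Longrightarrow> j < n \<Longrightarrow> \<Omega> $$ (i, j) = (\<Sum>y\<in>I. complex_of_real (w y) * M y $$ (i, j))"
    by (simp_all add: \<Omega>_def)
  have "hermitian \<Omega>"
    unfolding hermitian_def
  proof (rule eq_matI)
    fix i j assume "i < dim_row \<Omega>" "j < dim_col \<Omega>"
    then have ij: "i < n" "j < n"
      by (simp_all add: \<Omega>_def)
    have "cnj (M y $$ (j, i)) = M y $$ (i, j)" if "y \<in> I" for y
      using M[OF that] Mc[OF that] ij adjoint_index[of i "M y" j] by (simp add: psd_def hermitian_def)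
    then show "\<Omega>\<^sup>\<dagger> $$ (i, j) = \<Omega> $$ (i, j)"
      using ij \<Omega> by (simp add: adjoint_index \<Omega>_index)
  qed (use \<Omega> in auto)
  then obtain W l where W: "unitary n W" and l: "\<Omega> = spectral_mat n W (\<lambda>i. complex_of_real (l i))"
    using hermitian_spectral_mat[OF \<Omega>] by blast
  \<comment> \<open>In the basis \<open>W\<close> the \<open>i\<close>-th diagonal entries of the
    effects are nonnegative with sum 1, so one of them is positive, and \<open>l i\<close> is their
    combination with positive weights. The projection \<open>?T\<close> extracts these
    entries.\<close>
  have l_pos: "0 < l i" if i: "i < n" for i
  proof -
    let ?T = "spectral_mat n W (\<lambda>k. if k = i then 1 else 0)"
    have T: "mtrace (?T * A) = (W\<^sup>\<dagger> * A * W) $$ (i, i)" if "A \<in> carrier_mat n n" for A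
      using mtrace_spectral_mat_mult[OF W that] i by (simp add: if_distrib if_distribR cong: if_cong)
    have DM: "mtrace (?T * M y) = complex_of_real (diag_in W (M y) i)" if "y \<in> I" for y
      using T[OF Mc[OF that]] diag_in_psd(1)[OF W M[OF that] i] by simp
    have "complex_of_real (l i) = mtrace (?T * \<Omega>)"
      using T[OF \<Omega>] unitary_conj_spectral_mat[OF W l i] by simp
    also have "\<dots> = (\<Sum>y\<in>I. complex_of_real (w y) * mtrace (?T * M y))"
      using W \<Omega> Mc \<Omega>_index by (intro mtrace_mult_sum) auto
    also have "\<dots> = complex_of_real (\<Sum>y\<in>I. w y * diag_in W (M y) i)"
      by (simp add: DM)
    finally have li: "l i = (\<Sum>y\<in>I. w y * diag_in W (M y) i)"
      by (simp only: of_real_eq_iff)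
    have "mtrace (?T * 1\<^sub>m n) = (\<Sum>y\<in>I. 1 * mtrace (?T * M y))"
      using W Mc sum1 by (intro mtrace_mult_sum) auto
    moreover have "mtrace (?T * 1\<^sub>m n) = 1"
      using T[of "1\<^sub>m n"] W i by (simp add: one_square)
    ultimately have "complex_of_real (\<Sum>y\<in>I. diag_in W (M y) i) = complex_of_real 1"
      by (simp add: DM)
    then have "(\<Sum>y\<in>I. diag_in W (M y) i) = 1"
      by (simp only: of_real_eq_iff)
    then obtain y where y: "y \<in> I" "diag_in W (M y) i \<noteq> 0"
      by (metis sum.neutral zero_neq_one)
    have D: "0 \<le> diag_in W (M y) i" if "y \<in> I" for y
      using diag_in_psd(2)[OF W M[OF that] i] .
    show ?thesis
      unfolding li
    proof (rule sum_pos2[OF I(1) y(1)])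
      show "0 < w y * diag_in W (M y) i"
        using w[OF y(1)] D[OF y(1)] y(2) by simp
      show "0 \<le> w y * diag_in W (M y) i" if "y \<in> I" for y
        using w[OF that] D[OF that] by simp
    qed
  qed
  define P' where "P' i = diag_in W \<rho> i" for i
  define q' where "q' i = diag_in W \<sigma> i" for i
  have P': "0 < P' i" and q': "0 < q' i" if "i < n" for i
    using diag_in_pd(2)[OF W \<rho> that] diag_in_pd(2)[OF W \<sigma> that] by (simp_all add: P'_def q'_def)
  define K where "K = (\<Sum>i<n. l i powr b * P' i)"
  have K: "0 < K"
    unfolding K_def using P' l_pos n by (intro sum_pos) (auto simp: order_less_imp_not_eq2)
  \<comment> \<open>The Jensen inequality takes \<rho> in the form of \<open>R\<close> times its
    adjoint, so \<open>R\<close> will be the adjoint of \<open>G\<close>.\<close>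
  obtain G where G: "G \<in> carrier_mat n n" "\<rho> = G\<^sup>\<dagger> * G"
    using psd_gram[OF pd_imp_psd[OF \<rho>]] by blast
  have trK: "mtrace (cpow_mat n W l b * (G\<^sup>\<dagger> * (G\<^sup>\<dagger>)\<^sup>\<dagger>)) = complex_of_real K"
    unfolding adjoint_adjoint G(2)[symmetric] K_def P'_def by (rule mtrace_cpow) (use W l_pos \<rho> in auto)
  have trF: "(\<Sum>y\<in>I. complex_of_real (w y powr b) * mtrace (M y * (G\<^sup>\<dagger> * (G\<^sup>\<dagger>)\<^sup>\<dagger>))) = complex_of_real F"
    unfolding adjoint_adjoint G(2)[symmetric] F_def of_real_sum
  proof (intro sum.cong refl)
    fix y assume y: "y \<in> I"
    show "complex_of_real (w y powr b) * mtrace (M y * \<rho>) = complex_of_real (p y powr \<alpha> * q y powr (1 - \<alpha>))"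
      using powr_ratio_weight(1)[OF p[OF y] q[OF y]] \<alpha> by (simp add: tr_p[OF y] w_def b_def flip: of_real_mult)
  qed
  have sumw: "(\<Sum>y\<in>I. complex_of_real (w y) * M y $$ (i, j)) = spectral_mat n W (\<lambda>i. complex_of_real (l i)) $$ (i, j)"
    if "i < n" "j < n" for i j
    using \<Omega>_index[OF that] l by simp
  have L: "(\<Sum>i<n. l i * q' i) = F"
  proof -
    have "complex_of_real (\<Sum>i<n. l i * q' i) = mtrace (\<Omega> * \<sigma>)"
      unfolding l using mtrace_spectral_mat_mult[OF W carriers(2)] diag_in_pd(1)[OF W \<sigma>] by (simp add: q'_def)
    also have "\<dots> = mtrace (\<sigma> * \<Omega>)"
      using \<Omega> carriers(2) by (rule mtrace_comm_square)
    also have "\<dots> = (\<Sum>y\<in>I. complex_of_real (w y) * mtrace (\<sigma> * M y))"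
      using carriers(2) \<Omega> Mc \<Omega>_index by (intro mtrace_mult_sum) auto
    also have "\<dots> = complex_of_real F"
      unfolding F_def of_real_sum
    proof (intro sum.cong refl)
      fix y assume y: "y \<in> I"
      have "mtrace (\<sigma> * M y) = complex_of_real (q y)"
        using mtrace_comm_square[OF carriers(2) Mc[OF y]] tr_q[OF y] by simp
      then show "complex_of_real (w y) * mtrace (\<sigma> * M y) = complex_of_real (p y powr \<alpha> * q y powr (1 - \<alpha>))"
        using powr_ratio_weight(2)[OF p[OF y] q[OF y]] \<alpha> by (simp add: w_def flip: of_real_mult)
    qed
    finally show ?thesis
      by (simp only: of_real_eq_iff)
  qed
  have lin: "(\<Sum>i<n. \<alpha> * (l i powr b * P' i) + (1 - \<alpha>) * (l i * q' i)) = \<alpha> * K + (1 - \<alpha>) * F"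
    unfolding K_def L[symmetric] by (simp add: sum.distrib sum_distrib_left)
  \<comment> \<open>After this rescaling the tangent inequality applies termwise, and its linear
    side sums to the expression in \<open>lin\<close>.\<close>
  have basis: "basis_sum \<alpha> n \<rho> \<sigma> W = (\<Sum>i<n. (l i powr b * P' i) powr \<alpha> * (l i * q' i) powr (1 - \<alpha>))"
    unfolding basis_sum_def P'_def[symmetric] q'_def[symmetric] b_def
    using P' q' l_pos \<alpha> by (intro sum.cong refl powr_weight_cancel[symmetric]) auto
  have Gc: "G\<^sup>\<dagger> \<in> carrier_mat n n"
    using G(1) by simp
  have "1 / (\<alpha> - 1) * ln F \<le> 1 / (\<alpha> - 1) * ln (basis_sum \<alpha> n \<rho> \<sigma> W)"
  proof (cases "1 < \<alpha>")
    case True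
    then have b01: "0 < b" "b < 1"
      by (auto simp: b_def field_simps)
    have "F \<le> K"
      by (rule povm_jensen_pos[of I n M w W l "G\<^sup>\<dagger>" b F K]) (fact M w sum1 sumw W l_pos Gc trF trK F K b01)+
    then have "\<alpha> * F \<le> \<alpha> * K"
      using \<alpha> by simp
    then have "F \<le> \<alpha> * K + (1 - \<alpha>) * F"
      by (simp add: algebra_simps)
    also have "\<dots> \<le> basis_sum \<alpha> n \<rho> \<sigma> W"
      unfolding lin[symmetric] basis using True P' q' l_pos
      by (intro sum_mono powr_tangent_gt_1) (auto simp: order_less_imp_not_eq2)
    finally show ?thesis
      using True F by (simp add: divide_right_mono)
  next
    case False
    then have b01: "b < 0" "- 1 < b"
      using \<alpha> by (auto simp: b_def field_simps)
    have "K \<le> F"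
      by (rule povm_jensen_neg[of I n M w W l "G\<^sup>\<dagger>" b F K]) (fact M w sum1 sumw W l_pos Gc trF trK F K b01)+
    have "basis_sum \<alpha> n \<rho> \<sigma> W \<le> \<alpha> * K + (1 - \<alpha>) * F"
      unfolding lin[symmetric] basis using False \<alpha> P' q' l_pos
      by (intro sum_mono powr_tangent_lt_1) (auto simp: order_less_imp_not_eq2)
    also have "\<alpha> * K \<le> \<alpha> * F"
      using \<open>K \<le> F\<close> \<alpha> by simp
    then have "\<alpha> * K + (1 - \<alpha>) * F \<le> F"
      by (simp add: algebra_simps)
    finally show ?thesis
      using False \<alpha> basis_sum_pos[OF W] F by (simp add: divide_right_mono_neg)
  qed
  then show ?thesis
    using that W by (simp add: renyi)
qed

text \<open>A maximising basis exists by compactness. Attainment matters: equality of the supremum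
  with the sandwiched quantity has to be traced back to a single basis.\<close>

lemma measured_renyi_le_basis_sum:
  obtains W where "unitary n W" "measured_renyi n \<alpha> \<rho> \<sigma> \<le> ereal (1 / (\<alpha> - 1) * ln (basis_sum \<alpha> n \<rho> \<sigma> W))"
proof -
  have "continuous_on {\<phi>. unitary n (mat n n \<phi>)} (\<lambda>\<phi>. 1 / (\<alpha> - 1) * ln (basis_sum \<alpha> n \<rho> \<sigma> (mat n n \<phi>)))"
  proof (intro continuous_on_mult continuous_on_const continuous_on_ln ballI)
    show "continuous_on {\<phi>. unitary n (mat n n \<phi>)} (\<lambda>\<phi>. basis_sum \<alpha> n \<rho> \<sigma> (mat n n \<phi>))"
      unfolding basis_sum_def
    proof (intro continuous_on_sum continuous_on_mult continuous_on_powr continuous_on_const continuous_on_diag_in ballI carriers)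
      fix i \<phi> assume "i \<in> {..<n}" "\<phi> \<in> {\<phi>. unitary n (mat n n \<phi>)}"
      then show "diag_in (mat n n \<phi>) \<rho> i \<noteq> 0" "diag_in (mat n n \<phi>) \<sigma> i \<noteq> 0"
        using diag_in_pd(2)[of n "mat n n \<phi>" _ i] \<rho> \<sigma> by (auto simp: less_imp_neq[symmetric])
    qed auto
    show "basis_sum \<alpha> n \<rho> \<sigma> (mat n n \<phi>) \<noteq> 0" if "\<phi> \<in> {\<phi>. unitary n (mat n n \<phi>)}" for \<phi>
      using basis_sum_pos[of "mat n n \<phi>"] that by simp
  qed
  then obtain W where W: "unitary n W"
    "\<And>W'. unitary n W' \<Longrightarrow> 1 / (\<alpha> - 1) * ln (basis_sum \<alpha> n \<rho> \<sigma> W') \<le> 1 / (\<alpha> - 1) * ln (basis_sum \<alpha> n \<rho> \<sigma> W)"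
    by (rule unitary_attains_sup) blast
  have "measured_renyi n \<alpha> \<rho> \<sigma> \<le> ereal (1 / (\<alpha> - 1) * ln (basis_sum \<alpha> n \<rho> \<sigma> W))"
    unfolding measured_renyi_def
  proof (rule SUP_least, clarify)
    fix X M assume "povm n X M"
    then obtain W' where "unitary n W'"
      "1 / (\<alpha> - 1) * ln (renyi_sum \<alpha> \<rho> \<sigma> X M) \<le> 1 / (\<alpha> - 1) * ln (basis_sum \<alpha> n \<rho> \<sigma> W')"
      using renyi_sum_le_basis_sum by blast
    then show "ereal (1 / (\<alpha> - 1) * ln (renyi_sum \<alpha> \<rho> \<sigma> X M)) \<le> ereal (1 / (\<alpha> - 1) * ln (basis_sum \<alpha> n \<rho> \<sigma> W))"
      using W(2)[of W'] by simp
  qed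
  then show ?thesis
    using that W(1) by blast
qed

text \<open>Measuring in a joint eigenbasis yields the classical Renyi expression in the
  eigenvalues, to which the sandwiched quantity also reduces.\<close>

lemma sandwiched_le_measured_of_commute:
  assumes comm: "\<rho> * \<sigma> = \<sigma> * \<rho>"
  shows "ereal (sandwiched_renyi \<alpha> \<rho> \<sigma>) \<le> measured_renyi n \<alpha> \<rho> \<sigma>"
proof -
  obtain W r s where W: "unitary n W" and r: "\<rho> = spectral_mat n W (\<lambda>i. complex_of_real (r i))"
    and s: "\<sigma> = spectral_mat n W (\<lambda>i. complex_of_real (s i))"
    using commuting_hermitian_spectral_mat[OF _ _ _ _ comm, of n] \<rho> \<sigma> by (auto simp: pd_def)
  have r_pos: "0 < r i" and s_pos: "0 < s i" if "i < n" for i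
    using diag_in_pd[OF W \<rho> that] unitary_conj_spectral_mat[OF W r that]
      diag_in_pd[OF W \<sigma> that] unitary_conj_spectral_mat[OF W s that] by simp_all
  \<comment> \<open>The rank-one projection onto column \<open>i\<close> of
    \<open>W\<close>.\<close>
  define E where "E i = spectral_mat n W (\<lambda>k. if k = i then 1 else 0)" for i
  have E_index: "E i $$ (a, c) = W $$ (a, i) * cnj (W $$ (c, i))" if "i < n" "a < n" "c < n" for i a c
    using W that by (simp add: E_def spectral_mat_index if_distrib if_distribR cong: if_cong)
  have Ec: "E i \<in> carrier_mat n n" for i
    using W by (simp add: E_def)
  have psdE: "psd n (E i)" if i: "i < n" for i
    unfolding psd_def
  proof (intro conjI ballI)
    show "hermitian (E i)"
      using W by (simp add: hermitian_def E_def spectral_mat_adjoint if_distrib cong: if_cong)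
    fix v :: "complex Matrix.vec" assume v: "v \<in> carrier_vec n"
    \<comment> \<open>The inner product of column \<open>i\<close> with \<open>v\<close>; the
      quadratic form of \<open>E i\<close> is its squared modulus.\<close>
    define c where "c = (\<Sum>k<n. cnj (W $$ (k, i)) * vec_index v k)"
    have "scalar_prod (conjugate v) (E i *\<^sub>v v) = (\<Sum>a<n. cnj (vec_index v a) * (\<Sum>k<n. E i $$ (a, k) * vec_index v k))"
      using v Ec[of i] by (simp add: scalar_prod_def lessThan_atLeast0)
    also have "\<dots> = (\<Sum>a<n. cnj (vec_index v a) * W $$ (a, i) * c)"
      using i by (intro sum.cong refl) (simp add: E_index c_def sum_distrib_left mult_ac)
    also have "\<dots> = cnj c * c"
      unfolding sum_distrib_right[symmetric] by (simp add: c_def mult.commute)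
    also have "\<dots> = complex_of_real ((cmod c)\<^sup>2)"
      by (simp only: complex_norm_square mult.commute)
    finally show "0 \<le> scalar_prod (conjugate v) (E i *\<^sub>v v)"
      by (simp add: less_eq_complex_def)
  qed (use Ec in simp)
  have "povm n {..<n} E"
    unfolding povm_def
  proof (intro conjI allI impI ballI)
    fix i j assume ij: "i < n" "j < n"
    have "(\<Sum>y<n. E y $$ (i, j)) = (\<Sum>y<n. W $$ (i, y) * cnj (W $$ (j, y)))"
      using ij by (intro sum.cong) (auto simp: E_index)
    also have "\<dots> = (W * W\<^sup>\<dagger>) $$ (i, j)"
      using adjoint_mult_index(2)[of W n W i j] W ij by simp
    finally show "(\<Sum>y<n. E y $$ (i, j)) = (if i = j then 1 else 0)"
      using W ij by simp
  qed (auto intro: psdE)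
  then have "ereal (1 / (\<alpha> - 1) * ln (renyi_sum \<alpha> \<rho> \<sigma> {..<n} E)) \<le> measured_renyi n \<alpha> \<rho> \<sigma>"
    unfolding measured_renyi_def by (intro SUP_upper2[of "({..<n}, E)"]) auto
  moreover have "renyi_sum \<alpha> \<rho> \<sigma> {..<n} E = (\<Sum>i<n. r i powr \<alpha> * s i powr (1 - \<alpha>))"
    unfolding renyi_sum_def
  proof (intro sum.cong refl)
    fix i assume "i \<in> {..<n}"
    then have i: "i < n"
      by simp
    have "prob_meas A E i = Re ((W\<^sup>\<dagger> * A * W) $$ (i, i))" if "A \<in> carrier_mat n n" for A
      using mtrace_spectral_mat_mult[OF W that] i by (simp add: prob_meas_def E_def if_distrib if_distribR cong: if_cong)
    then have "prob_meas \<rho> E i = r i" "prob_meas \<sigma> E i = s i"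
      using carriers unitary_conj_spectral_mat[OF W r i] unitary_conj_spectral_mat[OF W s i] by simp_all
    then show "(if prob_meas \<rho> E i = 0 then 0 else prob_meas \<rho> E i powr \<alpha> * prob_meas \<sigma> E i powr (1 - \<alpha>)) = r i powr \<alpha> * s i powr (1 - \<alpha>)"
      using r_pos[OF i] by simp
  qed
  moreover have "sandwiched_renyi \<alpha> \<rho> \<sigma> = 1 / (\<alpha> - 1) * ln (\<Sum>i<n. r i powr \<alpha> * s i powr (1 - \<alpha>))"
  proof -
    define p where "p = (1 - \<alpha>) / (2 * \<alpha>)"
    have "mpow \<sigma> p * \<rho> * mpow \<sigma> p = spectral_mat n W (\<lambda>i. complex_of_real (s i powr p * r i * s i powr p))"
      unfolding mpow_spectral_mat[OF W s] by (subst (1) r) (simp add: spectral_mat_mult[OF W])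
    then have "mpow (mpow \<sigma> p * \<rho> * mpow \<sigma> p) \<alpha> = spectral_mat n W (\<lambda>i. complex_of_real ((s i powr p * r i * s i powr p) powr \<alpha>))"
      by (rule mpow_spectral_mat[OF W])
    then have "mtrace (mpow (mpow \<sigma> p * \<rho> * mpow \<sigma> p) \<alpha>) = complex_of_real (\<Sum>i<n. (s i powr p * r i * s i powr p) powr \<alpha>)"
      by (simp add: mtrace_spectral_mat[OF W])
    also have "(\<Sum>i<n. (s i powr p * r i * s i powr p) powr \<alpha>) = (\<Sum>i<n. r i powr \<alpha> * s i powr (1 - \<alpha>))"
    proof (intro sum.cong refl)
      fix i assume "i \<in> {..<n}"
      then have rs: "0 < r i" "0 < s i"
        using r_pos s_pos by auto
      have "s i powr (p * \<alpha>) * s i powr (p * \<alpha>) = s i powr (1 - \<alpha>)"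
      proof -
        have "p * \<alpha> + p * \<alpha> = 1 - \<alpha>"
          using \<alpha> by (simp add: p_def)
        then show ?thesis
          by (simp flip: powr_add)
      qed
      then show "(s i powr p * r i * s i powr p) powr \<alpha> = r i powr \<alpha> * s i powr (1 - \<alpha>)"
        using rs by (simp add: powr_mult powr_powr mult_ac)
    qed
    finally show ?thesis
      by (simp add: sandwiched_renyi_def p_def)
  qed
  ultimately show ?thesis
    by simp
qed

end

theorem theorem6:
  fixes d :: nat and \<rho> \<sigma> :: "complex mat" and \<alpha> :: real
  assumes "density d \<rho>" and "pd d \<rho>"
    and "psd d \<sigma>" and "pd d \<sigma>"
    and "\<alpha> \<in> {1/2<..<1} \<union> {1<..}"
  shows "measured_renyi d \<alpha> \<rho> \<sigma> \<le> ereal (sandwiched_renyi \<alpha> \<rho> \<sigma>)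
         \<and> (measured_renyi d \<alpha> \<rho> \<sigma> = ereal (sandwiched_renyi \<alpha> \<rho> \<sigma>) \<longleftrightarrow> \<rho> * \<sigma> = \<sigma> * \<rho>)"
proof -
  have \<alpha>: "1/2 < \<alpha>" "\<alpha> \<noteq> 1"
    using assms(5) by auto
  \<comment> \<open>In dimension 0 the trace would be the empty sum 0 instead of 1.\<close>
  have d: "0 < d"
    using assms(1) by (cases d) (auto simp: density_def psd_def mtrace_def)
  note ctx = assms(2,4) d \<alpha>
  obtain W where W: "unitary d W"
    and le: "measured_renyi d \<alpha> \<rho> \<sigma> \<le> ereal (1 / (\<alpha> - 1) * ln (basis_sum \<alpha> d \<rho> \<sigma> W))"
    using measured_renyi_le_basis_sum[OF ctx] by blast
  have sand: "ereal (1 / (\<alpha> - 1) * ln (basis_sum \<alpha> d \<rho> \<sigma> W)) \<le> ereal (sandwiched_renyi \<alpha> \<rho> \<sigma>)"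
    using basis_sum_sandwiched(1)[OF ctx W] by simp
  \<comment> \<open>The value at \<open>W\<close> lies between the measured and the sandwiched
    quantity, so their equality forces equality at \<open>W\<close>.\<close>
  have "\<rho> * \<sigma> = \<sigma> * \<rho>" if "measured_renyi d \<alpha> \<rho> \<sigma> = ereal (sandwiched_renyi \<alpha> \<rho> \<sigma>)"
    using le sand that by (intro basis_sum_sandwiched(2)[OF ctx W]) simp
  moreover have "measured_renyi d \<alpha> \<rho> \<sigma> = ereal (sandwiched_renyi \<alpha> \<rho> \<sigma>)" if "\<rho> * \<sigma> = \<sigma> * \<rho>"
    using sandwiched_le_measured_of_commute[OF ctx that] order_trans[OF le sand] by (rule antisym[rotated])
  ultimately show ?thesis
    using order_trans[OF le sand] by blast
qed

end
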